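(* Let $\mathbb{K}$ be a field of arbitrary characteristic and let $\mathcal{C}$ be an affine line arrangement in $V=\mathbb{K}^2$ with $\chi(\mathcal{C},t)=(t-a)(t-a-b)$, where $a,b\in\mathbb{C}$ and $|a|\le|a+b|$. Assume that $\mathcal{C}$ is free. Then: (1) $|\mathcal{C}\cap H|\in\mathbb{Z}_{\le a}\cup\{a+b\}$ for every $H\in\mathcal{C}$, and (2) $|\mathcal{C}\cap L|\in\{a\}\cup\mathbb{Z}_{\ge a+b}$ for every line $L\notin\mathcal{C}$ in $V$.
   Context: An affine line arrangement $\mathcal{C}$ in $V=\mathbb{K}^2$ is a finite set of affine lines in $V$. $L(\mathcal{C})$ is the set of all nonempty intersections of subsets of $\mathcal{C}$ (including $V$, the empty intersection). Define $\mu(V)=1$ and $\mu(X)=-\sum_{Y\in L(\mathcal{C}),\,X\subsetneq Y\subset V}\mu(Y)$; the characteristic polynomial is $\chi(\mathcal{C},t)=\sum_{X\in L(\mathcal{C})}\mu(X)t^{\dim X}$. For any line $H$ in $V$ (in $\mathcal{C}$ or not), $\mathcal{C}\cap H:=\{H\cap H'\mid H'\in\mathcal{C},\ H'\ne H,\ H\cap H'\neq\emptyset\}$ is the set of intersection points on $H$. Freeness: let $S=\mathbb{K}[x,y,z]$. The cone $c\mathcal{C}$ is the central arrangement in $\mathbb{K}^3$ consisting of the plane $z=0$ and the planes $cH=\{\alpha_{cH}=0\}$, $H\in\mathcal{C}$, where $\alpha_{cH}$ is the homogenization by $z$ of a degree one polynomial defining $H$. Let $D(c\mathcal{C})=\{\theta\in\mathrm{Der}\,S\mid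 \theta(\alpha_{cH})\in S\alpha_{cH}\ (\forall H\in\mathcal{C}),\ \theta(z)\in Sz\}$, where $\mathrm{Der}\,S$ is the module of $\mathbb{K}$-derivations of $S$. $\mathcal{C}$ is free with exponents $\exp_0(\mathcal{C})=(d_1,d_2)$ if $D(c\mathcal{C})$ is a free $S$-module with a homogeneous basis $\theta_E=x\partial_x+y\partial_y+z\partial_z,\theta_1,\theta_2$ with $\deg\theta_i=d_i$ (the degree of a homogeneous derivation is the polynomial degree of its coefficients). *)

theory Defs
  imports
    "HOL-Analysis.Analysis"
    "HOL-Computational_Algebra.Computational_Algebra"
    "HOL-Library.Complex_Order"
begin

section \<open>Affine line arrangements in the plane\<close>

definition line_of :: "'a::field \<Rightarrow> 'a \<Rightarrow> 'a \<Rightarrow> ('a ^ 2) set" where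
  "line_of p q r = {v. p * v $ 1 + q * v $ 2 + r = 0}"

definition affine_line :: "('a::field ^ 2) set \<Rightarrow> bool" where
  "affine_line H \<longleftrightarrow> (\<exists>p q r. (p \<noteq> 0 \<or> q \<noteq> 0) \<and> H = line_of p q r)"

definition line_arrangement :: "('a::field ^ 2) set set \<Rightarrow> bool" where
  "line_arrangement C \<longleftrightarrow> finite C \<and> (\<forall>H\<in>C. affine_line H)"

text \<open>The choice \<open>B = {}\<close> contributes the whole plane, since \<open>\<Inter>{} = UNIV\<close>.\<close>

definition intersection_poset :: "('a::field ^ 2) set set \<Rightarrow> ('a ^ 2) set set" where
  "intersection_poset C = {\<Inter>B | B. B \<subseteq> C} - {{}}"

lemma finite_intersection_poset:
  "finite C \<Longrightarrow> finite (intersection_poset C)"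
  unfolding intersection_poset_def by simp

text \<open>The guard \<open>finite C\<close> is there only to make the recursion well-founded; the
  value \<open>0\<close> for infinite \<open>C\<close> has no meaning.\<close>

function mu :: "('a::field ^ 2) set set \<Rightarrow> ('a ^ 2) set \<Rightarrow> int" where
  "mu C X =
    (if \<not> finite C then 0
     else if X = UNIV then 1
     else - (\<Sum>Y\<in>{Y \<in> intersection_poset C. X \<subset> Y}. mu C Y))"
  by pat_completeness auto
termination
proof (relation "Wellfounded.measure (\<lambda>(C, X). card {Y \<in> intersection_poset C. X \<subset> Y})")
  fix C :: "('a ^ 2) set set" and X Z :: "('a ^ 2) set"
  assume "\<not> \<not> finite C" and Z: "Z \<in> {Y \<in> intersection_poset C. X \<subset> Y}"
  then have "finite {Y \<in> intersection_poset C. X \<subset> Y}"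
    by (simp add: finite_intersection_poset)
  moreover from Z have
    "{Y \<in> intersection_poset C. Z \<subset> Y} \<subset> {Y \<in> intersection_poset C. X \<subset> Y}"
    by blast
  ultimately show "((C, Z), (C, X)) \<in> Wellfounded.measure (\<lambda>(C, X). card {Y \<in> intersection_poset C. X \<subset> Y})"
    by (simp add: psubset_card_mono)
qed simp

declare mu.simps [simp del]

text \<open>The dimension of a nonempty affine subspace is the dimension of its direction space.\<close>

definition flat_dim :: "('a::field ^ 2) set \<Rightarrow> nat" where
  "flat_dim X = vec.dim {u - v | u v. u \<in> X \<and> v \<in> X}"

definition char_poly :: "('a::field ^ 2) set set \<Rightarrow> int poly" where
  "char_poly C = (\<Sum>X\<in>intersection_poset C. monom (mu C X) (flat_dim X))"

definition points_on :: "('a::field ^ 2) set set \<Rightarrow> ('a ^ 2) set \<Rightarrow> ('a ^ 2) set set" where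
  "points_on C H = {H \<inter> H' | H'. H' \<in> C \<and> H' \<noteq> H \<and> H \<inter> H' \<noteq> {}}"


section \<open>Logarithmic derivations of the cone\<close>

text \<open>\<open>K[x,y,z]\<close> is represented as \<open>K[x][y][z]\<close>: the innermost variable is \<open>x\<close>, the
  outermost one is \<open>z\<close>.\<close>

type_synonym 'a poly3 = "'a poly poly poly"

definition const3 :: "'a::field \<Rightarrow> 'a poly3" where
  "const3 c = [:[:[:c:]:]:]"

definition var_x :: "'a::field poly3" where
  "var_x = [:[:[:0, 1:]:]:]"

definition var_y :: "'a::field poly3" where
  "var_y = [:[:0, 1:]:]"

definition var_z :: "'a::field poly3" where
  "var_z = [:0, 1:]"

definition homogeneous :: "nat \<Rightarrow> 'a::field poly3 \<Rightarrow> bool" where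
  "homogeneous d f \<longleftrightarrow>
    (\<forall>i j k. coeff (coeff (coeff f k) j) i \<noteq> 0 \<longrightarrow> i + j + k = d)"

definition derivation :: "('a::field poly3 \<Rightarrow> 'a poly3) \<Rightarrow> bool" where
  "derivation \<theta> \<longleftrightarrow>
    (\<forall>f g. \<theta> (f + g) = \<theta> f + \<theta> g) \<and>
    (\<forall>c f. \<theta> (const3 c * f) = const3 c * \<theta> f) \<and>
    (\<forall>f g. \<theta> (f * g) = f * \<theta> g + g * \<theta> f)"

definition homogeneous_derivation :: "nat \<Rightarrow> ('a::field poly3 \<Rightarrow> 'a poly3) \<Rightarrow> bool" where
  "homogeneous_derivation d \<theta> \<longleftrightarrow>
    derivation \<theta> \<and> homogeneous d (\<theta> var_x) \<and> homogeneous d (\<theta> var_y) \<and> homogeneous d (\<theta> var_z)"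

definition euler_derivation :: "'a::field poly3 \<Rightarrow> 'a poly3" where
  "euler_derivation f =
    var_x * map_poly (map_poly pderiv) f + var_y * map_poly pderiv f + var_z * pderiv f"

text \<open>The linear forms defining the planes of the cone: \<open>z\<close>, and the homogenizations
  \<open>p x + q y + r z\<close> of all degree one polynomials \<open>p x + q y + r\<close> defining a line of \<open>C\<close>.
  Every line contributes all nonzero scalar multiples of one form, which makes no difference for
  divisibility.\<close>

definition cone_forms :: "('a::field ^ 2) set set \<Rightarrow> 'a poly3 set" where
  "cone_forms C =
    insert var_z
      {const3 p * var_x + const3 q * var_y + const3 r * var_z | p q r.
        (p \<noteq> 0 \<or> q \<noteq> 0) \<and> line_of p q r \<in> C}"

definition log_derivations :: "('a::field ^ 2) set set \<Rightarrow> ('a poly3 \<Rightarrow> 'a poly3) set" where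
  "log_derivations C = {\<theta>. derivation \<theta> \<and> (\<forall>\<alpha>\<in>cone_forms C. \<alpha> dvd \<theta> \<alpha>)}"

definition free_with_exponents :: "('a::field ^ 2) set set \<Rightarrow> nat \<Rightarrow> nat \<Rightarrow> bool" where
  "free_with_exponents C d1 d2 \<longleftrightarrow>
    (\<exists>\<theta>1 \<theta>2.
      {euler_derivation, \<theta>1, \<theta>2} \<subseteq> log_derivations C \<and>
      homogeneous_derivation d1 \<theta>1 \<and> homogeneous_derivation d2 \<theta>2 \<and>
      (\<forall>\<theta>\<in>log_derivations C. \<exists>f0 f1 f2.
        \<theta> = (\<lambda>g. f0 * euler_derivation g + f1 * \<theta>1 g + f2 * \<theta>2 g)) \<and>
      (\<forall>f0 f1 f2.
        (\<lambda>g. f0 * euler_derivation g + f1 * \<theta>1 g + f2 * \<theta>2 g) = (\<lambda>g. 0) \<longrightarrow>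
        f0 = 0 \<and> f1 = 0 \<and> f2 = 0))"

definition free_arrangement :: "('a::field ^ 2) set set \<Rightarrow> bool" where
  "free_arrangement C \<longleftrightarrow> (\<exists>d1 d2. free_with_exponents C d1 d2)"

end

theory Submission imports Defs begin

text \<open>
  Put \<open>z = 1\<close>. Subtracting a multiple of the Euler derivation turns a logarithmic derivation of the
  cone into one that kills \<open>z\<close>, and this is a pair \<open>(f, g)\<close> of polynomials in \<open>x, y\<close> such that
  \<open>p f + q g\<close> is divisible by \<open>p x + q y + r\<close> for every line \<open>p x + q y + r = 0\<close> of \<open>C\<close>
  (\<open>log_pairs\<close>); the degree becomes a bound on the total degree. So a free arrangement with exponents
  \<open>(d1, d2)\<close> has two such pairs \<open>\<phi>, \<psi>\<close>, of degrees at most \<open>d1\<close> and \<open>d2\<close>, of which all others are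
  unique polynomial combinations, with the expected bounds on the degrees
  (\<open>free_log_basis\<close>).

  Let \<open>A\<close> be an arrangement of \<open>n\<close> lines, \<open>H\<close> a line outside \<open>A\<close> given by \<open>\<alpha> = p x + q y + r\<close>, and \<open>k\<close>
  the number of points in which \<open>A\<close> meets \<open>H\<close>. The polynomial \<open>p f + q g\<close>, restricted to \<open>H\<close>, vanishes
  to order \<open>m - 1\<close> at a point that lies on \<open>m\<close> lines of \<open>A\<close>, and its degree drops by one for each
  line of \<open>A\<close> parallel to \<open>H\<close>. These conditions amount to the divisibility by a form of degree
  \<open>n - k\<close>, and in degree at least \<open>n - 1\<close> every such polynomial occurs
  (\<open>restr_deriv_image_subset\<close>, \<open>restr_deriv_image_supset\<close>). This has three uses.

  \<^item> The kernel of the restriction consists of the logarithmic pairs of \<open>insert H A\<close>. Adding the lines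
    one at a time yields the dimension of the space of logarithmic pairs of large bounded degree, in
    terms of \<open>|C|\<close> and the constant coefficient \<open>b\<^sub>2\<close> of the characteristic polynomial
    (\<open>has_dim_log_pairs\<close>). A basis yields the same dimension in terms of \<open>d1\<close> and \<open>d2\<close>. Comparing the
    two gives \<open>|C| = d1 + d2\<close> and \<open>b\<^sub>2 = d1 d2\<close>, so \<open>d1\<close> and \<open>d2\<close> are the roots of the
    characteristic polynomial (\<open>exponents_sum_product\<close>).

  \<^item> A pair of degree less than \<open>n - k\<close> restricts to a pair tangent to \<open>H\<close>
    (\<open>restr_deriv_eq_0\<close>).

  \<^item> A tangent pair vanishes, on \<open>H\<close>, in all \<open>k\<close> points, so both components are divisible by \<open>\<alpha>\<close> if
    its degree is less than \<open>k\<close> (\<open>form_dvd_components\<close>).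

  The determinant of \<open>\<phi>, \<psi>\<close> is nonzero, its degree is at most \<open>d1 + d2 = |C|\<close>, and it is divisible by
  the product of the linear forms of \<open>C\<close>. There is no room for a further linear factor
  (\<open>pair_det_multiplicity\<close>).

  If \<open>L\<close> is not in \<open>C\<close> and has \<open>k < d2\<close> points, then \<open>\<phi>\<close> is tangent to \<open>L\<close>, because \<open>d1 < |C| - k\<close>. For
  \<open>d1 < k\<close> both components of \<open>\<phi>\<close> would be divisible by the form of \<open>L\<close>, and for \<open>k < d1\<close> also \<open>\<psi>\<close>
  would be tangent to \<open>L\<close>; in both cases this form would divide the determinant. Hence \<open>k = d1\<close>.

  If \<open>H\<close> is in \<open>C\<close> and has \<open>k > d1\<close> points, then \<open>\<phi> = \<alpha> \<phi>'\<close>, and \<open>\<phi>'\<close> is a logarithmic pair of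
  \<open>C - {H}\<close>. For \<open>k > d2\<close> also \<open>\<psi>\<close> would be divisible by \<open>\<alpha>\<close>, and for \<open>k < d2\<close> the pair \<open>\<phi>'\<close>
  would be tangent to \<open>H\<close>; in both cases \<open>\<alpha>\<^sup>2\<close> would divide the determinant. Hence \<open>k = d2\<close>.
\<close>

section \<open>Grading and total degree\<close>

locale ring_morphism =
  fixes h :: "'r::comm_ring_1 \<Rightarrow> 's::comm_ring_1"
  assumes hom_1: "h 1 = 1"
    and hom_add: "h (a + b) = h a + h b"
    and hom_mult: "h (a * b) = h a * h b"
begin

lemma hom_0: "h 0 = 0"
  using hom_add[of 0 0] by simp

lemma hom_uminus: "h (- a) = - h a"
  using hom_add[of a "- a"] by (simp add: hom_0 eq_neg_iff_add_eq_0 add.commute)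

lemma hom_diff: "h (a - b) = h a - h b"
  using hom_add[of a "- b"] by (simp add: hom_uminus)

lemma hom_prod: "h (prod f A) = (\<Prod>x\<in>A. h (f x))"
  by (induction A rule: infinite_finite_induct) (simp_all add: hom_1 hom_mult)

lemma hom_dvd: "a dvd b \<Longrightarrow> h a dvd h b"
  by (auto simp: hom_mult elim!: dvdE)

end

definition eval_at :: "('r::comm_ring_1 \<Rightarrow> 's::comm_ring_1) \<Rightarrow> 's \<Rightarrow> 'r poly \<Rightarrow> 's" where
  "eval_at h s p = poly (map_poly h p) s"

context ring_morphism
begin

lemma eval_at_pCons: "eval_at h s (pCons a p) = h a + s * eval_at h s p"
  by (simp add: eval_at_def map_poly_pCons hom_0)

lemma eval_at_0: "eval_at h s 0 = 0"
  by (simp add: eval_at_def)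

lemma eval_at_add: "eval_at h s (p + q) = eval_at h s p + eval_at h s q"
proof (induction p q rule: poly_induct2)
  case (pCons a p b q)
  then show ?case by (simp add: eval_at_pCons hom_add algebra_simps)
qed (simp add: eval_at_0)

lemma eval_at_smult: "eval_at h s (smult a p) = h a * eval_at h s p"
  by (induction p) (simp_all add: eval_at_0 eval_at_pCons hom_mult algebra_simps)

lemma ring_morphism_eval_at: "ring_morphism (eval_at h s)"
proof
  show "eval_at h s 1 = 1"
    by (simp add: one_pCons eval_at_pCons eval_at_0 hom_1)
  show "eval_at h s (p + q) = eval_at h s p + eval_at h s q" for p q
    by (rule eval_at_add)
  show "eval_at h s (p * q) = eval_at h s p * eval_at h s q" for p q
    by (induction p)
      (simp_all add: eval_at_0 eval_at_pCons eval_at_add eval_at_smult hom_0 algebra_simps)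
qed

end

text \<open>A strict bound on the degree, which the zero polynomial satisfies also for \<open>n = 0\<close>, makes this a
  space of dimension exactly \<open>n\<close>.\<close>

definition low_polys :: "nat \<Rightarrow> 'b::zero poly set" where
  "low_polys n = {p. \<forall>i\<ge>n. coeff p i = 0}"

lemma low_polys_iff: "p \<in> low_polys n \<longleftrightarrow> p = 0 \<or> degree p < n"
proof
  assume "p \<in> low_polys n"
  then show "p = 0 \<or> degree p < n"
    by (metis (mono_tags, lifting) leading_coeff_0_iff low_polys_def mem_Collect_eq not_le)
next
  assume "p = 0 \<or> degree p < n"
  then show "p \<in> low_polys n"
    by (auto simp: low_polys_def coeff_eq_0)
qed

lemma low_polys_mult:
  fixes p q :: "'b::idom poly"
  assumes "degree p \<le> e" "q \<in> low_polys n"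
  shows "p * q \<in> low_polys (e + n)"
  using assms degree_mult_le[of p q] by (auto simp: low_polys_iff)

lemma low_polys_mult_cancel:
  fixes p q :: "'b::idom poly"
  assumes "p * q \<in> low_polys n" "p \<noteq> 0"
  shows "q \<in> low_polys (n - degree p)"
  using assms by (cases "q = 0") (auto simp: low_polys_iff degree_mult_eq)

lemma low_polys_add: "p \<in> low_polys n \<Longrightarrow> q \<in> low_polys n \<Longrightarrow> p + q \<in> low_polys n"
  by (simp add: low_polys_def)

type_synonym 'a poly2 = "'a poly poly"

definition const2 :: "'a::comm_ring_1 \<Rightarrow> 'a poly2" where
  "const2 c = [:[:c:]:]"

text \<open>Morphisms into \<open>K[x,y][t]\<close> that record degrees in the exponent of \<open>t\<close>: they send \<open>x\<close> to \<open>x t\<close>, \<open>y\<close>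
  to \<open>y t\<close> and, in the case of \<open>graded3\<close>, \<open>z\<close> to \<open>t\<close>. So \<open>graded F\<close> is the sum of \<open>F\<^sub>k t\<^sup>k\<close> over the
  homogeneous components \<open>F\<^sub>k\<close> of \<open>F\<close>, and \<open>graded3 f\<close> is the sum of \<open>f\<^sub>k(x,y,1) t\<^sup>k\<close>. That these are
  ring morphisms into a polynomial ring over a domain gives all facts about total degrees and
  dehomogenization below.\<close>

definition graded_x :: "'a::idom poly \<Rightarrow> 'a poly2 poly" where
  "graded_x = eval_at (\<lambda>c. [:const2 c:]) [:0, [:[:0, 1:]:]:]"

definition graded :: "'a::idom poly2 \<Rightarrow> 'a poly2 poly" where
  "graded = eval_at graded_x [:0, [:0, 1:]:]"

definition graded3 :: "'a::idom poly2 poly \<Rightarrow> 'a poly2 poly" where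
  "graded3 = eval_at graded [:0, 1:]"

lemma ring_morphism_const2: "ring_morphism (\<lambda>c::'a::idom. const2 c)"
  unfolding const2_def by standard (simp_all add: one_pCons)

lemma ring_morphism_const2': "ring_morphism (\<lambda>c::'a::idom. [:const2 c:])"
  unfolding const2_def by standard (simp_all add: one_pCons)

interpretation const2: ring_morphism "const2 :: 'a::idom \<Rightarrow> _"
  by (rule ring_morphism_const2)

interpretation graded_x: ring_morphism "graded_x :: 'a::idom poly \<Rightarrow> _"
  unfolding graded_x_def
  by (rule ring_morphism.ring_morphism_eval_at[OF ring_morphism_const2'])

interpretation graded: ring_morphism "graded :: 'a::idom poly2 \<Rightarrow> _"
  unfolding graded_def
  by (rule ring_morphism.ring_morphism_eval_at) (rule graded_x.ring_morphism_axioms)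

interpretation graded3: ring_morphism "graded3 :: 'a::idom poly2 poly \<Rightarrow> _"
  unfolding graded3_def
  by (rule ring_morphism.ring_morphism_eval_at) (rule graded.ring_morphism_axioms)

lemma graded_x_pCons: "graded_x (pCons a p) = [:const2 a:] + [:0, [:[:0, 1:]:]:] * graded_x p"
  unfolding graded_x_def by (rule ring_morphism.eval_at_pCons[OF ring_morphism_const2'])

lemma graded_pCons: "graded (pCons a p) = graded_x a + [:0, [:0, 1:]:] * graded p"
  unfolding graded_def by (rule ring_morphism.eval_at_pCons[OF graded_x.ring_morphism_axioms])

lemma graded3_pCons: "graded3 (pCons a p) = graded a + [:0, 1:] * graded3 p"
  unfolding graded3_def by (rule ring_morphism.eval_at_pCons[OF graded.ring_morphism_axioms])

lemma coeff_graded_x: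
  "coeff (coeff (coeff (graded_x p) k) j) i = (if j = 0 \<and> i = k then coeff p i else 0)"
proof (induction p arbitrary: i k)
  case 0
  then show ?case by (simp add: graded_x.hom_0)
next
  case (pCons a p)
  then show ?case
    by (auto simp add: graded_x_pCons coeff_pCons const2_def split: nat.splits)
qed

lemma coeff_graded:
  "coeff (coeff (coeff (graded F) k) j) i = (if i + j = k then coeff (coeff F j) i else 0)"
proof (induction F arbitrary: j k)
  case 0
  then show ?case by (simp add: graded.hom_0)
next
  case (pCons a p)
  then show ?case
    by (simp add: graded_pCons coeff_pCons coeff_graded_x split: nat.split)
qed

lemma coeff_graded3:
  "coeff (coeff (coeff (graded3 f) n) j) i =
    (if i + j \<le> n then coeff (coeff (coeff f (n - i - j)) j) i else 0)"
proof (induction f arbitrary: n)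
  case 0
  then show ?case by (simp add: graded3.hom_0)
next
  case (pCons a p)
  show ?case
  proof (cases n)
    case 0
    then show ?thesis by (simp add: graded3_pCons coeff_graded)
  next
    case (Suc m)
    show ?thesis
    proof (cases "i + j \<le> m")
      case True
      then have "Suc m - i - j = Suc (m - i - j)" by simp
      then show ?thesis using Suc True
        by (simp add: graded3_pCons coeff_graded pCons.IH)
    next
      case False
      then show ?thesis using Suc
        by (auto simp add: graded3_pCons coeff_graded pCons.IH le_Suc_eq coeff_pCons split: nat.split)
    qed
  qed
qed

lemma poly2_eqI: "(\<And>i j. coeff (coeff F j) i = coeff (coeff G j) i) \<Longrightarrow> F = G"
  by (simp add: poly_eqI)

lemma poly3_eqI:
  "(\<And>i j k. coeff (coeff (coeff F k) j) i = coeff (coeff (coeff G k) j) i) \<Longrightarrow> F = G"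
  by (simp add: poly_eqI)

lemma graded_eq_0_iff: "graded F = 0 \<longleftrightarrow> F = 0"
proof
  assume *: "graded F = 0"
  show "F = 0"
  proof (rule poly2_eqI)
    fix i j
    show "coeff (coeff F j) i = coeff (coeff 0 j) i"
      using coeff_graded[of F "i + j" j i] * by simp
  qed
qed (simp add: graded.hom_0)

lemma graded3_eq_0_iff: "graded3 f = 0 \<longleftrightarrow> f = 0"
proof
  assume *: "graded3 f = 0"
  show "f = 0"
  proof (rule poly3_eqI)
    fix i j k
    show "coeff (coeff (coeff f k) j) i = coeff (coeff (coeff 0 k) j) i"
      using coeff_graded3[of f "i + j + k" j i] * by simp
  qed
qed (simp add: graded3.hom_0)

lemma graded3_inject: "graded3 f = graded3 g \<longleftrightarrow> f = g"
  using graded3_eq_0_iff[of "f - g"] by (simp add: graded3.hom_diff)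

definition tdeg :: "'a::idom poly2 \<Rightarrow> nat" where
  "tdeg F = degree (graded F)"

definition low_polys2 :: "nat \<Rightarrow> 'a::idom poly2 set" where
  "low_polys2 n = {F. graded F \<in> low_polys n}"

lemma low_polys2_iff: "F \<in> low_polys2 n \<longleftrightarrow> F = 0 \<or> tdeg F < n"
  by (simp add: low_polys2_def low_polys_iff tdeg_def graded_eq_0_iff)

lemma low_polys2_coeff: "F \<in> low_polys2 n \<longleftrightarrow> (\<forall>i j. n \<le> i + j \<longrightarrow> coeff (coeff F j) i = 0)"
proof
  assume "F \<in> low_polys2 n"
  then have "coeff (graded F) k = 0" if "n \<le> k" for k
    using that by (simp add: low_polys2_def low_polys_def)
  then show "\<forall>i j. n \<le> i + j \<longrightarrow> coeff (coeff F j) i = 0"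
    by (metis coeff_0 coeff_graded)
next
  assume "\<forall>i j. n \<le> i + j \<longrightarrow> coeff (coeff F j) i = 0"
  then show "F \<in> low_polys2 n"
    by (auto simp: low_polys2_def low_polys_def coeff_graded intro!: poly2_eqI)
qed

lemma tdeg_mult: "F \<noteq> 0 \<Longrightarrow> G \<noteq> 0 \<Longrightarrow> tdeg (F * G) = tdeg F + tdeg G"
  by (simp add: tdeg_def graded.hom_mult degree_mult_eq graded_eq_0_iff)

lemma low_polys2_add: "F \<in> low_polys2 n \<Longrightarrow> G \<in> low_polys2 n \<Longrightarrow> F + G \<in> low_polys2 n"
  by (simp add: low_polys2_coeff)

lemma low_polys2_mult: "tdeg F \<le> e \<Longrightarrow> G \<in> low_polys2 n \<Longrightarrow> F * G \<in> low_polys2 (e + n)"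
  by (auto simp: low_polys2_def tdeg_def graded.hom_mult low_polys_mult)

lemma low_polys2_mult_cancel:
  "F * G \<in> low_polys2 n \<Longrightarrow> F \<noteq> 0 \<Longrightarrow> G \<in> low_polys2 (n - tdeg F)"
  by (auto simp: low_polys2_def tdeg_def graded.hom_mult graded_eq_0_iff
      intro: low_polys_mult_cancel)

lemma low_polys2_mono: "m \<le> n \<Longrightarrow> low_polys2 m \<subseteq> low_polys2 n"
  by (auto simp: low_polys2_coeff)

lemma graded_const2: "graded (const2 c) = [:const2 c:]"
  by (simp add: const2_def graded_pCons graded.hom_0 graded_x_pCons graded_x.hom_0)

lemma tdeg_const2 [simp]: "tdeg (const2 c) = 0"
  by (simp add: tdeg_def graded_const2)

lemma tdeg_prod:
  assumes "finite A" "\<And>x. x \<in> A \<Longrightarrow> F x \<noteq> 0"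
  shows "tdeg (\<Prod>x\<in>A. F x) = (\<Sum>x\<in>A. tdeg (F x))"
  using assms
proof (induction A rule: finite_induct)
  case empty
  have "tdeg (const2 1) = 0" by (rule tdeg_const2)
  then show ?case by (simp add: const2.hom_1)
next
  case (insert x A)
  then show ?case by (simp add: tdeg_mult prod_zero_iff)
qed

definition lin :: "'a::comm_ring_1 \<Rightarrow> 'a \<Rightarrow> 'a \<Rightarrow> 'a poly2" where
  "lin p q r = [:[:r, p:], [:q:]:]"

lemma tdeg_lin:
  assumes "p \<noteq> 0 \<or> q \<noteq> 0"
  shows "tdeg (lin p q r) = 1"
proof -
  have "graded (lin p q r) = [:[:[:r:]:], [:[:0, p:], [:q:]:]:]"
    by (simp add: lin_def graded_pCons graded.hom_0 graded_x_pCons graded_x.hom_0 const2_def)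
  then show ?thesis using assms by (simp add: tdeg_def)
qed

lemma lin_nonzero: "p \<noteq> 0 \<or> q \<noteq> 0 \<Longrightarrow> lin p q r \<noteq> 0"
  by (auto simp: lin_def)

text \<open>The coefficient of \<open>z\<^sup>k\<close> in the homogenization is the component of degree \<open>d - k\<close>.\<close>

lemma homogenization:
  assumes "F \<in> low_polys2 (Suc d)"
  obtains f where "graded3 f = monom F d"
proof -
  define f where "f = (\<Sum>k\<le>d. monom (coeff (graded F) (d - k)) k)"
  have cf: "coeff f k = (if k \<le> d then coeff (graded F) (d - k) else 0)" for k
    by (auto simp: f_def coeff_sum sum.delta')
  have "graded3 f = monom F d"
  proof (rule poly3_eqI)
    fix i j n
    show "coeff (coeff (coeff (graded3 f) n) j) i = coeff (coeff (coeff (monom F d) n) j) i"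
      using assms by (auto simp: coeff_graded3 cf coeff_graded low_polys2_coeff)
  qed
  then show ?thesis by (rule that)
qed

lemma coeff_graded3_low: "coeff (graded3 f) d \<in> low_polys2 (Suc d)"
  by (auto simp: low_polys2_coeff coeff_graded3)

lemma graded3_homogeneous:
  assumes "homogeneous d f"
  shows "graded3 f = monom (coeff (graded3 f) d) d"
proof (rule poly_eqI)
  fix n
  have "coeff (graded3 f) n = 0" if "n \<noteq> d"
  proof (rule poly2_eqI)
    fix i j
    show "coeff (coeff (coeff (graded3 f) n) j) i = coeff (coeff 0 j) i"
    proof (cases "i + j \<le> n")
      case True
      then have "i + j + (n - i - j) \<noteq> d" using that by simp
      with assms have "coeff (coeff (coeff f (n - i - j)) j) i = 0"
        unfolding homogeneous_def by blast
      then show ?thesis by (simp add: coeff_graded3)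
    qed (simp add: coeff_graded3)
  qed
  then show "coeff (graded3 f) n = coeff (monom (coeff (graded3 f) d) d) n" by simp
qed

section \<open>Dimensions\<close>

text \<open>In contrast to \<open>dim\<close>, this includes that \<open>V\<close> is a subspace and has a finite basis; the ambient
  spaces of polynomials are infinite-dimensional.\<close>

definition (in vector_space) has_dim :: "'b set \<Rightarrow> nat \<Rightarrow> bool" where
  "has_dim V n \<longleftrightarrow> (\<exists>B. finite B \<and> independent B \<and> span B = V \<and> card B = n)"

context vector_space
begin

lemma has_dim_subspace: "has_dim V n \<Longrightarrow> subspace V"
  by (auto simp: has_dim_def)

lemma has_dim_unique: "has_dim V m \<Longrightarrow> has_dim V n \<Longrightarrow> m = n"
  by (metis dim_eq_card_independent dim_span has_dim_def)

lemma has_dim_zero: "has_dim {0} 0"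
  unfolding has_dim_def by (rule exI[of _ "{}"]) (simp add: independent_empty)

lemma subspace_has_dim:
  assumes "has_dim V n" "subspace U" "U \<subseteq> V"
  obtains m where "has_dim U m"
proof -
  obtain B where B: "finite B" "span B = V"
    using assms(1) by (auto simp: has_dim_def)
  obtain B' where B': "B' \<subseteq> U" "independent B'" "U \<subseteq> span B'"
    by (rule basis_exists[of U])
  have "finite B'"
  proof -
    have "B' \<subseteq> span B" using B'(1) B(2) assms(3) by (metis order_trans)
    then show ?thesis using independent_span_bound[OF B(1) B'(2)] by simp
  qed
  moreover have "span B' = U"
    using span_minimal[OF B'(1) assms(2)] B'(3) by (rule subset_antisym)
  ultimately have "has_dim U (card B')"
    unfolding has_dim_def using B'(2) by (intro exI[of _ B'] conjI refl)
  then show ?thesis by (rule that)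
qed

end

context vector_space_pair
begin

lemma has_dim_injective_image:
  assumes "Vector_Spaces.linear s1 s2 f" "vs1.has_dim V n" "\<And>v. v \<in> V \<Longrightarrow> f v = 0 \<Longrightarrow> v = 0"
  shows "vs2.has_dim (f ` V) n"
proof -
  interpret f: Vector_Spaces.linear s1 s2 f by fact
  obtain B where B: "finite B" "vs1.independent B" "vs1.span B = V" "card B = n"
    using assms(2) by (auto simp: vs1.has_dim_def)
  have inj: "inj_on f (vs1.span B)"
    using f.inj_on_iff_eq_0[OF vs1.subspace_span] assms(3) B(3) by blast
  have "vs2.independent (f ` B)"
    using f.independent_injective_image[OF B(2) inj] .
  moreover have "card (f ` B) = n"
    using card_image[OF inj_on_subset[OF inj vs1.span_superset]] B(4) by simp
  moreover have "vs2.span (f ` B) = f ` V"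
    using f.span_image[of B] B(3) by simp
  ultimately show ?thesis using B(1) by (auto simp: vs2.has_dim_def)
qed

text \<open>Lift a basis of the image and join it to a basis of the kernel.\<close>

lemma rank_nullity:
  assumes f: "Vector_Spaces.linear s1 s2 f" and V: "vs1.subspace V"
    and ker: "vs1.has_dim {v \<in> V. f v = 0} m" and img: "vs2.has_dim (f ` V) n"
  shows "vs1.has_dim V (m + n)"
proof -
  interpret f: Vector_Spaces.linear s1 s2 f by fact
  interpret swap: vector_space_pair s2 s1 by unfold_locales
  obtain g where g: "g ` UNIV \<subseteq> V" "Vector_Spaces.linear s2 s1 g" "\<And>v. v \<in> f ` V \<Longrightarrow> f (g v) = v"
    using linear_exists_right_inverse_on[OF f V] by blast
  interpret g: Vector_Spaces.linear s2 s1 g by (rule g)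
  have "vs1.has_dim (g ` (f ` V)) n"
    using swap.has_dim_injective_image[OF g(2) img] g(3) f.zero by metis
  then obtain B where B: "finite B" "vs1.independent B" "vs1.span B = g ` (f ` V)" "card B = n"
    by (auto simp: vs1.has_dim_def)
  obtain K where K: "finite K" "vs1.independent K" "vs1.span K = {v \<in> V. f v = 0}" "card K = m"
    using ker by (auto simp: vs1.has_dim_def)
  have 0: "v = 0" if "v \<in> vs1.span K" "v \<in> vs1.span B" for v
    using that K(3) B(3) g(3) g.zero by force
  have disj: "K \<inter> B = {}"
    using 0 vs1.span_superset vs1.dependent_zero K(2) by blast
  have "vs1.independent (K \<union> B)"
    unfolding vs1.dependent_finite[OF finite_UnI[OF K(1) B(1)]]
  proof (rule notI, elim exE conjE bexE)
    fix u v
    assume u: "(\<Sum>v\<in>K \<union> B. s1 (u v) v) = 0" and v: "v \<in> K \<union> B" "u v \<noteq> 0"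
    have s: "(\<Sum>v\<in>K. s1 (u v) v) + (\<Sum>v\<in>B. s1 (u v) v) = 0"
      using u by (simp add: sum.union_disjoint[OF K(1) B(1) disj])
    have b: "(\<Sum>v\<in>B. s1 (u v) v) \<in> vs1.span B" and k: "(\<Sum>v\<in>K. s1 (u v) v) \<in> vs1.span K"
      by (rule vs1.span_sum, rule vs1.span_scale, rule vs1.span_base, simp)+
    have "(\<Sum>v\<in>B. s1 (u v) v) = - (\<Sum>v\<in>K. s1 (u v) v)"
      using s by (simp add: add_eq_0_iff)
    then have "(\<Sum>v\<in>B. s1 (u v) v) \<in> vs1.span K" using vs1.span_neg[OF k] by simp
    then have "(\<Sum>v\<in>B. s1 (u v) v) = 0" using 0 b by blast
    moreover from this s have "(\<Sum>v\<in>K. s1 (u v) v) = 0" by simp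
    ultimately have "\<forall>v\<in>K \<union> B. u v = 0"
      using K(1,2) B(1,2) vs1.dependent_finite by blast
    with v show False by blast
  qed
  moreover have "vs1.span (K \<union> B) = V"
  proof
    have "K \<subseteq> V" "B \<subseteq> V" using K(3) B(3) g(1) vs1.span_superset by blast+
    then show "vs1.span (K \<union> B) \<subseteq> V" using V by (simp add: vs1.span_minimal)
    show "V \<subseteq> vs1.span (K \<union> B)"
    proof
      fix v assume v: "v \<in> V"
      have gf: "g (f v) \<in> V" using g(1) by blast
      have "v - g (f v) \<in> vs1.span K"
        using v gf V g(3) by (auto simp: K(3) f.diff vs1.subspace_diff)
      moreover have "g (f v) \<in> vs1.span B" using B(3) v by blast
      ultimately have "(v - g (f v)) + g (f v) \<in> vs1.span (K \<union> B)"
        by (meson Un_upper1 Un_upper2 subsetD vs1.span_add vs1.span_mono)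
      then show "v \<in> vs1.span (K \<union> B)" by simp
    qed
  qed
  moreover have "card (K \<union> B) = m + n"
    using card_Un_disjoint[OF K(1) B(1) disj] K(4) B(4) by simp
  ultimately show ?thesis using K(1) B(1) unfolding vs1.has_dim_def by blast
qed

lemma has_dim_kernel:
  assumes f: "Vector_Spaces.linear s1 s2 f" and V: "vs1.has_dim V m" and img: "vs2.has_dim (f ` V) n"
  shows "n \<le> m" "vs1.has_dim {v \<in> V. f v = 0} (m - n)"
proof -
  interpret f: Vector_Spaces.linear s1 s2 f by fact
  have sub: "vs1.subspace V" using V by (rule vs1.has_dim_subspace)
  have "vs1.subspace {v \<in> V. f v = 0}"
    using sub by (auto simp: vs1.subspace_def f.add f.scale f.zero)
  then obtain k where k: "vs1.has_dim {v \<in> V. f v = 0} k"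
    using vs1.subspace_has_dim[OF V] by blast
  have "m = k + n"
    using vs1.has_dim_unique[OF V rank_nullity[OF f sub k img]] .
  then show "n \<le> m" "vs1.has_dim {v \<in> V. f v = 0} (m - n)" using k by auto
qed

end

definition scale2 :: "'a::field \<Rightarrow> 'a poly2 \<Rightarrow> 'a poly2" where
  "scale2 c F = const2 c * F"

definition scale_pair :: "'a::field \<Rightarrow> 'a poly2 \<times> 'a poly2 \<Rightarrow> 'a poly2 \<times> 'a poly2" where
  "scale_pair c \<phi> = (const2 c * fst \<phi>, const2 c * snd \<phi>)"

interpretation poly1: vector_space "smult :: 'a::field \<Rightarrow> 'a poly \<Rightarrow> 'a poly"
  by standard (simp_all add: smult_add_left smult_add_right)

interpretation poly2: vector_space "scale2 :: 'a::field \<Rightarrow> 'a poly2 \<Rightarrow> 'a poly2"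
  by standard (simp_all add: scale2_def const2.hom_add const2.hom_mult const2.hom_1 algebra_simps)

interpretation pairs: vector_space "scale_pair :: 'a::field \<Rightarrow> _"
  by standard
    (simp_all add: scale_pair_def const2.hom_add const2.hom_mult const2.hom_1 algebra_simps)

interpretation poly1_base: vector_space_pair smult "(*) :: 'a::field \<Rightarrow> 'a \<Rightarrow> 'a" ..
interpretation poly1_poly1: vector_space_pair smult "smult :: 'a::field \<Rightarrow> 'a poly \<Rightarrow> 'a poly" ..
interpretation poly2_poly1: vector_space_pair scale2 "smult :: 'a::field \<Rightarrow> 'a poly \<Rightarrow> 'a poly" ..
interpretation poly2_poly2: vector_space_pair scale2 "scale2 :: 'a::field \<Rightarrow> _" ..
interpretation pairs_poly1: vector_space_pair scale_pair "smult :: 'a::field \<Rightarrow> 'a poly \<Rightarrow> 'a poly" ..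
interpretation pairs_poly2: vector_space_pair scale_pair "scale2 :: 'a::field \<Rightarrow> _" ..
interpretation poly2_pairs: vector_space_pair "scale2 :: 'a::field \<Rightarrow> _" scale_pair ..
interpretation pairs_pairs: vector_space_pair scale_pair "scale_pair :: 'a::field \<Rightarrow> _" ..

lemma has_dim_base: "vector_space_over_itself.has_dim (UNIV :: 'a::field set) 1"
proof -
  have "c \<in> vector_space_over_itself.span {1}" for c :: 'a
    using vector_space_over_itself.span_scale[OF vector_space_over_itself.span_base[of 1 "{1}"], of c] by simp
  then have "vector_space_over_itself.span {1} = (UNIV :: 'a set)" by blast
  then show ?thesis
    unfolding vector_space_over_itself.has_dim_def by (intro exI[of _ "{1}"]) simp
qed

lemma low_polys_Suc: "pCons a p \<in> low_polys (Suc n) \<longleftrightarrow> p \<in> low_polys n"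
  by (auto simp: low_polys_iff)

lemma has_dim_low_polys: "poly1.has_dim (low_polys n :: 'a::field poly set) n"
proof (induction n)
  case 0
  have "low_polys 0 = {0 :: 'a poly}" by (auto simp: low_polys_iff)
  then show ?case using poly1.has_dim_zero by simp
next
  case (Suc n)
  let ?V = "low_polys (Suc n) :: 'a poly set"
  have "Vector_Spaces.linear smult smult (pCons (0::'a))"
    by unfold_locales (simp_all add: algebra_simps)
  then have "poly1.has_dim (pCons 0 ` low_polys n :: 'a poly set) n"
    by (rule poly1_poly1.has_dim_injective_image[OF _ Suc]) simp
  moreover have "pCons 0 ` low_polys n = {v \<in> ?V. coeff v 0 = 0}"
  proof (intro equalityI subsetI)
    fix v assume "v \<in> {v \<in> ?V. coeff v 0 = 0}"
    then show "v \<in> pCons 0 ` low_polys n"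
      by (cases v rule: pCons_cases) (auto simp: low_polys_Suc)
  qed (auto simp: low_polys_Suc)
  ultimately have "poly1.has_dim {v \<in> ?V. coeff v 0 = 0} n" by simp
  moreover have "Vector_Spaces.linear smult (*) (\<lambda>v::'a poly. coeff v 0)"
    by unfold_locales (simp_all add: algebra_simps)
  moreover have "c \<in> (\<lambda>v. coeff v 0) ` ?V" for c
    by (rule image_eqI[of _ _ "[:c:]"]) (simp_all add: low_polys_Suc low_polys_iff)
  then have "(\<lambda>v. coeff v 0) ` ?V = UNIV" by blast
  moreover have "poly1.subspace ?V"
    by (auto simp: poly1.subspace_def low_polys_def)
  ultimately have "poly1.has_dim ?V (n + 1)"
    using poly1_base.rank_nullity[of "\<lambda>v. coeff v 0" ?V n 1] has_dim_base by simp
  then show ?case by simp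
qed

lemma low_polys2_Suc:
  "pCons a F \<in> low_polys2 (Suc n) \<longleftrightarrow> a \<in> low_polys (Suc n) \<and> F \<in> low_polys2 n"
proof
  assume "pCons a F \<in> low_polys2 (Suc n)"
  then have *: "coeff (coeff (pCons a F) j) i = 0" if "Suc n \<le> i + j" for i j
    using that by (simp add: low_polys2_coeff)
  have "coeff a i = 0" if "Suc n \<le> i" for i using *[of i 0] that by simp
  moreover have "coeff (coeff F j) i = 0" if "n \<le> i + j" for i j using *[of i "Suc j"] that by simp
  ultimately show "a \<in> low_polys (Suc n) \<and> F \<in> low_polys2 n"
    by (simp add: low_polys2_coeff low_polys_def)
next
  assume "a \<in> low_polys (Suc n) \<and> F \<in> low_polys2 n"
  then show "pCons a F \<in> low_polys2 (Suc n)"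
    by (auto simp: low_polys2_coeff low_polys_def coeff_pCons split: nat.split)
qed

lemma const2_mult_pCons: "const2 c * pCons a F = pCons (smult c a) (const2 c * F)"
  by (simp add: const2_def)

text \<open>As \<open>low_polys2 (Suc n)\<close> modulo the multiples of \<open>y\<close> is \<open>low_polys (Suc n)\<close>, the dimension is
  \<open>1 + 2 + \<dots> + n\<close>.\<close>

lemma has_dim_low_polys2:
  "poly2.has_dim (low_polys2 n :: 'a::field poly2 set) (n * (n + 1) div 2)"
proof (induction n)
  case 0
  have "low_polys2 0 = {0 :: 'a poly2}" by (auto simp: low_polys2_iff)
  then show ?case using poly2.has_dim_zero by simp
next
  case (Suc n)
  let ?V = "low_polys2 (Suc n) :: 'a poly2 set"
  have "Vector_Spaces.linear scale2 scale2 (pCons (0::'a poly))"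
    by unfold_locales (simp_all add: scale2_def const2_mult_pCons)
  then have "poly2.has_dim (pCons 0 ` low_polys2 n :: 'a poly2 set) (n * (n + 1) div 2)"
    by (rule poly2_poly2.has_dim_injective_image[OF _ Suc]) simp
  moreover have "pCons 0 ` low_polys2 n = {v \<in> ?V. coeff v 0 = 0}"
  proof (intro equalityI subsetI)
    fix v assume "v \<in> {v \<in> ?V. coeff v 0 = 0}"
    then show "v \<in> pCons 0 ` low_polys2 n"
      by (cases v rule: pCons_cases) (auto simp: low_polys2_Suc)
  qed (auto simp: low_polys2_Suc low_polys_def)
  ultimately have "poly2.has_dim {v \<in> ?V. coeff v 0 = 0} (n * (n + 1) div 2)" by simp
  moreover have "Vector_Spaces.linear scale2 smult (\<lambda>v::'a poly2. coeff v 0)"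
    by unfold_locales (simp_all add: scale2_def const2_def)
  moreover have "c \<in> (\<lambda>v. coeff v 0) ` ?V" if "c \<in> low_polys (Suc n)" for c
  proof (rule image_eqI)
    show "[:c:] \<in> ?V"
      unfolding low_polys2_Suc using that by (simp add: low_polys2_iff)
  qed simp
  then have "(\<lambda>v. coeff v 0) ` ?V = low_polys (Suc n)"
  proof (intro equalityI subsetI)
    fix a assume "a \<in> (\<lambda>v. coeff v 0) ` ?V"
    then obtain v where v: "v \<in> ?V" "a = coeff v 0" by blast
    then show "a \<in> low_polys (Suc n)"
      by (simp add: low_polys2_coeff low_polys_def)
  qed blast
  moreover have "poly2.subspace ?V"
    by (auto simp: poly2.subspace_def low_polys2_coeff scale2_def const2_def)
  ultimately have "poly2.has_dim ?V (n * (n + 1) div 2 + Suc n)"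
    using poly2_poly1.rank_nullity[of "\<lambda>v. coeff v 0" ?V "n * (n + 1) div 2" "Suc n"] has_dim_low_polys[of "Suc n", where 'a='a] by simp
  moreover have "n * (n + 1) div 2 + Suc n = Suc n * (Suc n + 1) div 2"
  proof -
    have "Suc n * (Suc n + 1) = n * (n + 1) + Suc n * 2" by simp
    then show ?thesis by (metis div_mult_self1 zero_neq_numeral add.commute)
  qed
  ultimately show ?case by simp
qed

lemma has_dim_Times:
  assumes "poly2.has_dim U m" "poly2.has_dim (V :: 'a::field poly2 set) n"
  shows "pairs.has_dim (U \<times> V) (m + n)"
proof -
  have U: "poly2.subspace U" and V: "poly2.subspace V"
    using assms poly2.has_dim_subspace by blast+
  have 0: "0 \<in> U" "0 \<in> V" using poly2.subspace_0 U V by blast+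
  have "Vector_Spaces.linear scale2 scale_pair (\<lambda>F::'a poly2. (F, 0))"
    by unfold_locales (simp_all add: scale2_def scale_pair_def)
  from poly2_pairs.has_dim_injective_image[OF this assms(1)]
  have "pairs.has_dim ((\<lambda>F. (F, 0)) ` U) m" by (simp add: zero_prod_def)
  also have "(\<lambda>F. (F, 0)) ` U = {v \<in> U \<times> V. snd v = 0}"
    using 0 by auto
  finally have "pairs.has_dim {v \<in> U \<times> V. snd v = 0} m" .
  moreover have "Vector_Spaces.linear scale_pair scale2 (snd :: 'a poly2 \<times> 'a poly2 \<Rightarrow> _)"
    by unfold_locales (simp_all add: scale2_def scale_pair_def)
  moreover have "pairs.subspace (U \<times> V)"
    using U V by (auto simp: poly2.subspace_def pairs.subspace_def scale2_def scale_pair_def zero_prod_def)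
  moreover have "snd ` (U \<times> V) = V" using 0 by force
  ultimately show ?thesis
    using pairs_poly2.rank_nullity[of snd "U \<times> V" m n] assms(2) by simp
qed

section \<open>Restricting polynomials to a line\<close>

text \<open>An equation of a line is determined up to a scalar only; one is chosen once and for all.\<close>

definition line_coeffs :: "('a::field ^ 2) set \<Rightarrow> 'a \<times> 'a \<times> 'a" where
  "line_coeffs H = (SOME c. case c of (p, q, r) \<Rightarrow> (p \<noteq> 0 \<or> q \<noteq> 0) \<and> H = line_of p q r)"

definition coeff_x :: "('a::field ^ 2) set \<Rightarrow> 'a" where "coeff_x H = fst (line_coeffs H)"
definition coeff_y :: "('a::field ^ 2) set \<Rightarrow> 'a" where "coeff_y H = fst (snd (line_coeffs H))"
definition coeff_1 :: "('a::field ^ 2) set \<Rightarrow> 'a" where "coeff_1 H = snd (snd (line_coeffs H))"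

lemma line_coeffs:
  assumes "affine_line H"
  shows "coeff_x H \<noteq> 0 \<or> coeff_y H \<noteq> 0" "H = line_of (coeff_x H) (coeff_y H) (coeff_1 H)"
proof -
  have "\<exists>c. case c of (p, q, r) \<Rightarrow> (p \<noteq> 0 \<or> q \<noteq> 0) \<and> H = line_of p q r"
    using assms by (auto simp: affine_line_def)
  from someI_ex[OF this]
  have "case line_coeffs H of (p, q, r) \<Rightarrow> (p \<noteq> 0 \<or> q \<noteq> 0) \<and> H = line_of p q r"
    unfolding line_coeffs_def .
  then show "coeff_x H \<noteq> 0 \<or> coeff_y H \<noteq> 0" "H = line_of (coeff_x H) (coeff_y H) (coeff_1 H)"
    by (simp_all only: coeff_x_def coeff_y_def coeff_1_def case_prod_beta)
qed

lemma mem_line_iff: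
  "affine_line H \<Longrightarrow> v \<in> H \<longleftrightarrow> coeff_x H * v $ 1 + coeff_y H * v $ 2 + coeff_1 H = 0"
  using line_coeffs(2)[of H] by (auto simp: line_of_def)

definition form :: "('a::field ^ 2) set \<Rightarrow> 'a poly2" where
  "form H = lin (coeff_x H) (coeff_y H) (coeff_1 H)"

text \<open>A point \<open>(base1 H, base2 H)\<close> of the line, and the parametrization of the line that starts at it.\<close>

definition base1 :: "('a::field ^ 2) set \<Rightarrow> 'a" where
  "base1 H = (if coeff_y H = 0 then - coeff_1 H / coeff_x H else 0)"

definition base2 :: "('a::field ^ 2) set \<Rightarrow> 'a" where
  "base2 H = (if coeff_y H = 0 then 0 else - coeff_1 H / coeff_y H)"

definition param :: "('a::field ^ 2) set \<Rightarrow> 'a \<Rightarrow> 'a ^ 2" where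
  "param H t = vector [base1 H + t * coeff_y H, base2 H - t * coeff_x H]"

lemma base_on_line: "affine_line H \<Longrightarrow> coeff_x H * base1 H + coeff_y H * base2 H + coeff_1 H = 0"
  using line_coeffs(1)[of H] by (auto simp: base1_def base2_def)

lemma param_nth: "param H t $ 1 = base1 H + t * coeff_y H" "param H t $ 2 = base2 H - t * coeff_x H"
  by (simp_all add: param_def)

lemma param_mem: "affine_line H \<Longrightarrow> param H t \<in> H"
  using base_on_line[of H] by (simp add: mem_line_iff param_nth algebra_simps)

lemma inj_param:
  assumes "affine_line H"
  shows "inj (param H)"
proof (rule injI)
  fix s t assume "param H s = param H t"
  then have "param H s $ 1 = param H t $ 1" "param H s $ 2 = param H t $ 2" by simp_all
  then show "s = t" using line_coeffs(1)[OF assms] by (auto simp: param_nth)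
qed

lemma param_surj:
  assumes "affine_line H" "v \<in> H"
  obtains t where "v = param H t"
proof -
  have v: "coeff_x H * (v $ 1 - base1 H) + coeff_y H * (v $ 2 - base2 H) = 0"
  proof -
    have "coeff_x H * (v $ 1 - base1 H) + coeff_y H * (v $ 2 - base2 H) =
        (coeff_x H * v $ 1 + coeff_y H * v $ 2 + coeff_1 H) - (coeff_x H * base1 H + coeff_y H * base2 H + coeff_1 H)"
      by (simp add: algebra_simps)
    then show ?thesis using assms mem_line_iff[of H v] base_on_line[of H] by simp
  qed
  define t where "t = (if coeff_y H = 0 then (base2 H - v $ 2) / coeff_x H else (v $ 1 - base1 H) / coeff_y H)"
  have "v = param H t"
    unfolding vec_eq_iff forall_2 param_nth
  proof (cases "coeff_y H = 0")
    case True
    with v line_coeffs(1)[OF assms(1)]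
    show "v $ 1 = base1 H + t * coeff_y H \<and> v $ 2 = base2 H - t * coeff_x H" by (simp add: t_def)
  next
    case False
    have t: "t * coeff_y H = v $ 1 - base1 H" using False by (simp add: t_def)
    have "coeff_y H * (v $ 2 - base2 H + t * coeff_x H) = coeff_x H * (t * coeff_y H) + coeff_y H * (v $ 2 - base2 H)"
      by (simp add: algebra_simps)
    also have "\<dots> = 0" unfolding t by (rule v)
    finally have "v $ 2 - base2 H + t * coeff_x H = 0" using False by simp
    then have "v $ 2 = base2 H - t * coeff_x H" by (metis add_uminus_conv_diff diff_eq_eq eq_neg_iff_add_eq_0 add.commute)
    then show "v $ 1 = base1 H + t * coeff_y H \<and> v $ 2 = base2 H - t * coeff_x H"
      using t by simp
  qed
  then show ?thesis by (rule that)
qed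

text \<open>The restriction of a polynomial to the line, as a polynomial in the parameter \<open>t\<close>. Over a finite
  field this carries more information than the restricted function, and so detects divisibility by
  the linear form in every characteristic (\<open>restr_eq_0_iff\<close>).\<close>

definition restr :: "('a::field ^ 2) set \<Rightarrow> 'a poly2 \<Rightarrow> 'a poly" where
  "restr H = eval_at (\<lambda>a. pcompose a [:base1 H, coeff_y H:]) [:base2 H, - coeff_x H:]"

lemma ring_morphism_pcompose: "ring_morphism (\<lambda>a. pcompose a (X :: 'a::idom poly))"
  by standard (simp_all add: pcompose_1 pcompose_add pcompose_mult)

interpretation restr: ring_morphism "restr H" for H :: "('a::field ^ 2) set"
  unfolding restr_def by (rule ring_morphism.ring_morphism_eval_at[OF ring_morphism_pcompose])

lemma restr_pCons:
  "restr H (pCons a F) = pcompose a [:base1 H, coeff_y H:] + [:base2 H, - coeff_x H:] * restr H F"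
  unfolding restr_def by (rule ring_morphism.eval_at_pCons[OF ring_morphism_pcompose])

lemma restr_const2 [simp]: "restr H (const2 c) = [:c:]"
  by (simp add: const2_def restr_pCons restr.hom_0)

lemma restr_lin:
  "restr H (lin p q r) = [:p * base1 H + q * base2 H + r, p * coeff_y H - q * coeff_x H:]"
  by (simp add: lin_def restr_pCons restr.hom_0 pcompose_pCons algebra_simps)

lemma restr_form_self: "affine_line H \<Longrightarrow> restr H (form H) = 0"
  using base_on_line[of H] by (simp add: form_def restr_lin mult.commute)

lemma poly_restr_form:
  "affine_line H' \<Longrightarrow> poly (restr H (form H')) t = 0 \<longleftrightarrow> param H t \<in> H'"
  by (simp add: form_def restr_lin mem_line_iff param_nth algebra_simps)

lemma restr_low_polys: "F \<in> low_polys2 n \<Longrightarrow> restr H F \<in> low_polys n"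
proof (induction F arbitrary: n)
  case 0
  then show ?case by (simp add: restr.hom_0 low_polys_iff)
next
  case (pCons a F)
  show ?case
  proof (cases n)
    case 0
    with pCons.prems pCons.hyps show ?thesis by (auto simp: low_polys2_iff)
  next
    case (Suc m)
    with pCons.prems have a: "a \<in> low_polys n" and F: "F \<in> low_polys2 m"
      by (simp_all add: low_polys2_Suc)
    have "degree (pcompose a [:base1 H, coeff_y H:]) \<le> degree a * degree [:base1 H, coeff_y H:]"
      by (rule degree_pcompose_le)
    also have "\<dots> \<le> degree a * 1" by (intro mult_le_mono2) simp
    finally have "pcompose a [:base1 H, coeff_y H:] \<in> low_polys n"
      using a by (auto simp: low_polys_iff)
    moreover have "[:base2 H, - coeff_x H:] * restr H F \<in> low_polys (1 + m)"
      by (rule low_polys_mult[OF _ pCons.IH[OF F]]) simp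
    ultimately show ?thesis unfolding restr_pCons using Suc by (simp add: low_polys_add)
  qed
qed

text \<open>Some affine function on the plane restricts to the parameter \<open>t\<close> itself.\<close>

lemma restr_surj:
  assumes H: "affine_line (H :: ('a::field ^ 2) set)" and s: "s \<in> low_polys n"
  obtains F where "F \<in> low_polys2 n" "restr H F = s"
proof -
  obtain p q r :: 'a where pq: "p \<noteq> 0 \<or> q \<noteq> 0" and t: "restr H (lin p q r) = [:0, 1:]"
  proof (cases "coeff_y H = 0")
    case True
    then show ?thesis using that[of 0 "- 1 / coeff_x H" "base2 H / coeff_x H"] line_coeffs(1)[OF H]
      by (simp add: restr_lin)
  next
    case False
    then show ?thesis using that[of "1 / coeff_y H" 0 "- base1 H / coeff_y H"] by (simp add: restr_lin)
  qed
  have "\<exists>F. F \<in> low_polys2 n \<and> restr H F = s"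
    using s
  proof (induction s arbitrary: n)
    case 0
    then show ?case by (intro exI[of _ 0]) (simp add: low_polys2_iff restr.hom_0)
  next
    case (pCons a s)
    show ?case
    proof (cases n)
      case 0
      with pCons.prems pCons.hyps show ?thesis by (auto simp: low_polys_iff)
    next
      case (Suc m)
      with pCons.prems have "s \<in> low_polys m" by (simp add: low_polys_Suc)
      from pCons.IH[OF this] obtain F where F: "F \<in> low_polys2 m" "restr H F = s" by blast
      have "lin p q r * F \<in> low_polys2 (1 + m)"
        by (rule low_polys2_mult[OF _ F(1)]) (simp add: tdeg_lin[OF pq])
      then have "const2 a + lin p q r * F \<in> low_polys2 n"
        unfolding Suc by (intro low_polys2_add) (simp_all add: low_polys2_iff)
      moreover have "restr H (const2 a + lin p q r * F) = pCons a s"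
        by (simp add: restr.hom_add restr.hom_mult t F)
      ultimately show ?thesis by blast
    qed
  qed
  then show ?thesis using that by blast
qed

text \<open>If \<open>y\<close> occurs in the linear form, divide by it with remainder with respect to \<open>y\<close>; the remainder is a
  polynomial in \<open>x\<close>, which is nonconstant on the line. Otherwise the form is a multiple of \<open>x - c\<close>, and
  a polynomial is divisible by it if all its coefficients with respect to \<open>y\<close> vanish at \<open>c\<close>.\<close>

lemma restr_eq_0_iff:
  assumes H: "affine_line (H :: ('a::field ^ 2) set)"
  shows "restr H F = 0 \<longleftrightarrow> form H dvd F"
proof
  assume "form H dvd F"
  then show "restr H F = 0"
    using restr.hom_dvd[of "form H" F H] restr_form_self[OF H] by simp
next
  assume F: "restr H F = 0"
  show "form H dvd F"
  proof (cases "coeff_y H = 0")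
    case False
    define l where "l = [:- coeff_1 H / coeff_y H, - coeff_x H / coeff_y H:]"
    have f: "form H = const2 (coeff_y H) * [:- l, 1:]"
      using False by (simp add: form_def lin_def const2_def l_def)
    have "[:- l, 1:] dvd F - [:poly F l:]"
      by (subst poly_eq_0_iff_dvd[symmetric]) simp
    then obtain k where k: "F - [:poly F l:] = [:- l, 1:] * k" by (elim dvdE)
    have "const2 (coeff_y H) * const2 (1 / coeff_y H) = (1 :: 'a poly2)"
      using False by (simp add: const2_def one_pCons)
    then have "F - [:poly F l:] = const2 (coeff_y H) * const2 (1 / coeff_y H) * ([:- l, 1:] * k)"
      using k by simp
    then have "F - [:poly F l:] = form H * (const2 (1 / coeff_y H) * k)"
      unfolding f by (simp only: mult_ac)
    then have d: "form H dvd F - [:poly F l:]" by (rule dvdI)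
    then have "restr H (F - [:poly F l:]) = 0"
      using restr.hom_dvd[OF d, of H] restr_form_self[OF H] by simp
    then have "pcompose (poly F l) [:base1 H, coeff_y H:] = 0"
      using F by (simp add: restr.hom_diff restr_pCons restr.hom_0)
    then have "poly F l = 0"
      using pcompose_eq_0[of "poly F l" "[:base1 H, coeff_y H:]"] False by simp
    then show ?thesis using d by simp
  next
    case True
    then have p: "coeff_x H \<noteq> 0" using line_coeffs(1)[OF H] by simp
    have r: "restr H G = pcompose (map_poly (\<lambda>c. poly c (base1 H)) G) [:base2 H, - coeff_x H:]" for G
      by (induction G)
        (simp_all add: restr.hom_0 restr_pCons map_poly_pCons pcompose_pCons True pcompose_pCons_0)
    have "map_poly (\<lambda>c. poly c (base1 H)) F = 0"
      using F p pcompose_eq_0[of "map_poly (\<lambda>c. poly c (base1 H)) F" "[:base2 H, - coeff_x H:]"]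
      by (simp add: r)
    then have "poly (coeff F j) (base1 H) = 0" for j
      by (metis coeff_0 coeff_map_poly poly_0)
    then have "[:- base1 H, 1:] dvd coeff F j" for j
      by (simp add: poly_eq_0_iff_dvd)
    then have "smult (coeff_x H) [:- base1 H, 1:] dvd coeff F j" for j
      using p by (simp add: smult_dvd_iff del: smult_pCons)
    moreover have "smult (coeff_x H) [:- base1 H, 1:] = [:coeff_1 H, coeff_x H:]"
      using p True by (simp add: base1_def)
    ultimately have "[:[:coeff_1 H, coeff_x H:]:] dvd F"
      by (simp add: const_poly_dvd_iff)
    moreover have "form H = [:[:coeff_1 H, coeff_x H:]:]"
      using True by (simp add: form_def lin_def)
    ultimately show ?thesis by simp
  qed
qed

lemma proportional_coeffs:
  fixes p q :: "'a::field"
  assumes pq: "p \<noteq> 0 \<or> q \<noteq> 0" and on: "p * u + q * v + r = 0" "p' * u + q' * v + r' = 0"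
    and par: "p' * q = q' * p"
  obtains c where "p' = c * p" "q' = c * q" "r' = c * r"
proof -
  define c where "c = (if p = 0 then q' / q else p' / p)"
  have c: "p' = c * p" "q' = c * q"
    using pq par by (auto simp: c_def field_simps)
  have r: "r = - (p * u + q * v)" and r': "r' = - (p' * u + q' * v)"
    using on by (metis add.commute eq_neg_iff_add_eq_0)+
  have "r' = c * r" unfolding r r' c by (simp add: algebra_simps)
  with c show ?thesis by (rule that)
qed

lemma lin_scale: "lin (c * p) (c * q) (c * r) = const2 c * lin p q r"
  by (simp add: lin_def const2_def)

text \<open>All equations of a line are proportional, so a condition on the chosen one holds for all.\<close>

lemma lin_of_line:
  fixes H :: "('a::field ^ 2) set"
  assumes "line_of p q r = H" "affine_line H"
  obtains c where "p = c * coeff_x H" "q = c * coeff_y H" "r = c * coeff_1 H" "lin p q r = const2 c * form H"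
proof -
  have on: "p * v $ 1 + q * v $ 2 + r = 0" if "v \<in> H" for v :: "'a ^ 2"
    using that assms(1) by (auto simp: line_of_def)
  have 0: "p * base1 H + q * base2 H + r = 0"
    using on[OF param_mem[OF assms(2), of 0]] by (simp add: param_nth)
  have "p * (base1 H + coeff_y H) + q * (base2 H - coeff_x H) + r = 0"
    using on[OF param_mem[OF assms(2), of 1]] by (simp add: param_nth)
  moreover have "p * coeff_y H - q * coeff_x H =
      (p * (base1 H + coeff_y H) + q * (base2 H - coeff_x H) + r) - (p * base1 H + q * base2 H + r)"
    by (simp add: algebra_simps)
  ultimately have "p * coeff_y H = q * coeff_x H" using 0 by simp
  from proportional_coeffs[OF line_coeffs(1)[OF assms(2)] base_on_line[OF assms(2)] 0 this]
  obtain c where "p = c * coeff_x H" "q = c * coeff_y H" "r = c * coeff_1 H" by blast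
  moreover from this have "lin p q r = const2 c * form H" by (simp add: form_def lin_scale)
  ultimately show ?thesis by (rule that)
qed

lemma restr_form_eq_0_iff:
  fixes H :: "('a::field ^ 2) set"
  assumes H: "affine_line H" and H': "affine_line H'"
  shows "restr H (form H') = 0 \<longleftrightarrow> H' = H"
proof
  assume "restr H (form H') = 0"
  then have "coeff_x H' * base1 H + coeff_y H' * base2 H + coeff_1 H' = 0" "coeff_x H' * coeff_y H = coeff_y H' * coeff_x H"
    by (simp_all add: form_def restr_lin)
  from proportional_coeffs[OF line_coeffs(1)[OF H] base_on_line[OF H] this]
  obtain c where c: "coeff_x H' = c * coeff_x H" "coeff_y H' = c * coeff_y H" "coeff_1 H' = c * coeff_1 H" by blast
  then have "c \<noteq> 0" using line_coeffs(1)[OF H'] by auto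
  show "H' = H"
  proof (rule set_eqI)
    fix v :: "'a ^ 2"
    have "coeff_x H' * v $ 1 + coeff_y H' * v $ 2 + coeff_1 H' = c * (coeff_x H * v $ 1 + coeff_y H * v $ 2 + coeff_1 H)"
      by (simp add: c algebra_simps)
    then show "v \<in> H' \<longleftrightarrow> v \<in> H"
      using \<open>c \<noteq> 0\<close> by (simp add: mem_line_iff[OF H] mem_line_iff[OF H'])
  qed
qed (simp add: restr_form_self H)

lemma form_nonzero: "affine_line H \<Longrightarrow> form H \<noteq> 0"
  unfolding form_def by (rule lin_nonzero) (rule line_coeffs)

lemma tdeg_form: "affine_line H \<Longrightarrow> tdeg (form H) = 1"
  unfolding form_def by (rule tdeg_lin) (rule line_coeffs)

text \<open>The form of a line is a prime element: it generates the kernel of a morphism into a domain.\<close>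

lemma form_power_mult_dvd:
  assumes H: "affine_line H" and "form H ^ k dvd F" "D dvd F" "restr H D \<noteq> 0"
  shows "form H ^ k * D dvd F"
  using assms(2)
proof (induction k)
  case 0
  then show ?case using assms by simp
next
  case (Suc k)
  have "form H ^ k dvd F" using Suc.prems by (metis dvd_mult_right power_Suc)
  from Suc.IH[OF this] obtain E where E: "F = form H ^ k * D * E" by (elim dvdE)
  have "form H dvd D * E"
    using Suc.prems form_nonzero[OF H] unfolding E power_Suc2 mult.assoc by simp
  then have "restr H D * restr H E = 0"
    by (simp add: restr_eq_0_iff[OF H, symmetric] restr.hom_mult)
  then have "form H dvd E" using assms(4) by (simp add: restr_eq_0_iff[OF H, symmetric])
  then obtain E' where "E = form H * E'" by (elim dvdE)
  then have "F = (form H ^ Suc k * D) * E'" unfolding E by (simp add: mult_ac)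
  then show ?case by (rule dvdI)
qed

lemma prod_forms_dvd:
  assumes "finite A" "\<And>H. H \<in> A \<Longrightarrow> affine_line H" "\<And>H. H \<in> A \<Longrightarrow> form H dvd F"
  shows "(\<Prod>H\<in>A. form H) dvd F"
  using assms
proof (induction A rule: finite_induct)
  case (insert H A)
  have "restr H (\<Prod>H\<in>A. form H) \<noteq> 0"
    using insert by (auto simp: restr.hom_prod restr_form_eq_0_iff)
  then have "form H ^ 1 * (\<Prod>H\<in>A. form H) dvd F"
    using insert by (intro form_power_mult_dvd) auto
  then show ?case using insert by simp
qed simp

lemma tdeg_prod_forms:
  assumes "finite A" "\<And>H. H \<in> A \<Longrightarrow> affine_line H"
  shows "tdeg (\<Prod>H\<in>A. form H) = card A"
  using assms by (simp add: tdeg_prod form_nonzero tdeg_form)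

section \<open>Divisibility and interpolation in one variable\<close>

lemma linear_powers_prod_dvd:
  fixes p :: "'a::field poly"
  assumes "finite T" "\<And>t. t \<in> T \<Longrightarrow> [:- t, 1:] ^ e t dvd p"
  shows "(\<Prod>t\<in>T. [:- t, 1:] ^ e t) dvd p"
  using assms
proof (induction T rule: finite_induct)
  case (insert t T)
  show ?case
  proof (cases "p = 0")
    case False
    let ?D = "\<Prod>t\<in>T. [:- t, 1:] ^ e t"
    have "?D dvd p" using insert by blast
    then obtain E where E: "p = ?D * E" by (elim dvdE)
    have "poly ?D t \<noteq> 0" using insert.hyps by (auto simp: poly_prod)
    then have "order t ?D = 0" by (rule order_0I)
    then have "order t p = order t E" using False unfolding E by (subst order_mult) auto
    then have "[:- t, 1:] ^ e t dvd E"
      using insert.prems[of t] False E by (auto simp: order_divides)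
    then show ?thesis using insert.hyps by (subst E) (simp add: mult.commute mult_dvd_mono)
  qed simp
qed simp

text \<open>Lagrange interpolation with polynomial weights: the products that omit one node span, with
  coefficients of degree less than \<open>e\<close>, all polynomials of degree less than \<open>e + |T| - 1\<close>. The set \<open>S\<close> is
  arbitrary, in order that the induction can pass to the cofactors of \<open>t - t0\<close>.\<close>

lemma lagrange_span:
  fixes g :: "'a::field poly"
  assumes "finite T" "T \<noteq> {}" "0 < e" "g \<in> low_polys (e + card T - 1)"
    and "\<And>u v. u \<in> S \<Longrightarrow> v \<in> S \<Longrightarrow> u + v \<in> S"
    and "\<And>t s. t \<in> T \<Longrightarrow> s \<in> low_polys e \<Longrightarrow> s * (\<Prod>t\<in>T - {t}. [:- t, 1:]) \<in> S"
  shows "g \<in> S"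
  using assms
proof (induction T arbitrary: g S rule: finite_ne_induct)
  case (singleton t)
  then show ?case using singleton.prems(4)[of t g] by simp
next
  case (insert t0 T)
  let ?P = "\<Prod>t\<in>T. [:- t, 1:]"
  define c where "c = poly g t0 / poly ?P t0"
  have P0: "poly ?P t0 \<noteq> 0" using insert.hyps by (auto simp: poly_prod)
  have "degree ?P = card T" by (subst degree_prod_eq_sum_degree) auto
  then have P: "?P \<in> low_polys (e + card T)" using insert.prems(1) by (simp add: low_polys_iff)
  have "g \<in> low_polys (e + card T)" using insert.prems(2) insert.hyps by simp
  then have d: "g - [:c:] * ?P \<in> low_polys (e + card T)"
    using P by (simp add: low_polys_def)
  have "poly (g - [:c:] * ?P) t0 = 0" using P0 by (simp add: c_def)
  then obtain g' where g': "g - [:c:] * ?P = [:- t0, 1:] * g'"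
    unfolding poly_eq_0_iff_dvd by (elim dvdE)
  have "g' \<in> low_polys (e + card T - 1)"
    using low_polys_mult_cancel[of "[:- t0, 1:]" g' "e + card T"] d unfolding g' by simp
  then have "g' \<in> {u. [:- t0, 1:] * u \<in> S}"
  proof (rule insert.IH[OF insert.prems(1)])
    fix t and s :: "'a poly" assume t: "t \<in> T" and s: "s \<in> low_polys e"
    have "insert t0 T - {t} = insert t0 (T - {t})" using t insert.hyps by auto
    then have "(\<Prod>t\<in>insert t0 T - {t}. [:- t, 1:]) = [:- t0, 1:] * (\<Prod>t\<in>T - {t}. [:- t, 1:])"
      using insert.hyps by simp
    then show "s * (\<Prod>t\<in>T - {t}. [:- t, 1:]) \<in> {u. [:- t0, 1:] * u \<in> S}"
      using insert.prems(4)[of t s] t s by (simp only: mem_Collect_eq) (metis insertI2 mult.left_commute)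
  next
    fix u v assume "u \<in> {u. [:- t0, 1:] * u \<in> S}" "v \<in> {u. [:- t0, 1:] * u \<in> S}"
    then show "u + v \<in> {u. [:- t0, 1:] * u \<in> S}"
      using insert.prems(3) by (simp add: distrib_left del: mult_pCons_left)
  qed
  then have 1: "[:- t0, 1:] * g' \<in> S" by simp
  have "insert t0 T - {t0} = T" using insert.hyps by auto
  moreover have "[:c:] \<in> low_polys e" using insert.prems(1) by (simp add: low_polys_iff)
  ultimately have 2: "[:c:] * ?P \<in> S" using insert.prems(4)[of t0 "[:c:]"] by simp
  have "g = [:- t0, 1:] * g' + [:c:] * ?P" by (simp only: g'[symmetric]) simp
  then show ?case using insert.prems(3)[OF 1 2] by simp
qed

section \<open>Restricting logarithmic pairs to a further line\<close>

text \<open>The pair \<open>(f, g)\<close> stands for the derivation \<open>f \<partial>\<^sub>x + g \<partial>\<^sub>y\<close>; this is its value at the form of \<open>H\<close>.\<close>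

definition deriv_form :: "('a::field ^ 2) set \<Rightarrow> 'a poly2 \<times> 'a poly2 \<Rightarrow> 'a poly2" where
  "deriv_form H \<phi> = const2 (coeff_x H) * fst \<phi> + const2 (coeff_y H) * snd \<phi>"

text \<open>The degree bound is strict, as in \<open>low_polys\<close>; pairs of degree at most \<open>d\<close> form \<open>log_pairs (Suc d)\<close>.\<close>

definition log_pairs :: "nat \<Rightarrow> ('a::field ^ 2) set set \<Rightarrow> ('a poly2 \<times> 'a poly2) set" where
  "log_pairs n A = {\<phi>. fst \<phi> \<in> low_polys2 n \<and> snd \<phi> \<in> low_polys2 n \<and>
    (\<forall>H\<in>A. form H dvd deriv_form H \<phi>)}"

lemma dvd_const2_mult_iff:
  fixes F G :: "'a::field poly2"
  assumes "c \<noteq> 0"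
  shows "F dvd const2 c * G \<longleftrightarrow> F dvd G"
proof
  assume "F dvd const2 c * G"
  then have "F dvd const2 (1 / c) * (const2 c * G)" by (rule dvd_mult)
  moreover have "const2 (1 / c) * const2 c = 1"
    using assms by (simp add: const2_def one_pCons)
  then have "const2 (1 / c) * (const2 c * G) = G"
    by (simp add: mult.assoc[symmetric])
  ultimately show "F dvd G" by simp
qed simp

lemma deriv_form_low_polys2:
  "\<phi> \<in> log_pairs n A \<Longrightarrow> deriv_form H \<phi> \<in> low_polys2 n"
  using low_polys2_mult[of "const2 _" 0 _ n]
  by (auto simp: deriv_form_def log_pairs_def intro!: low_polys2_add)

lemma low_polys2_minus: "F \<in> low_polys2 n \<Longrightarrow> - F \<in> low_polys2 n"
  by (simp add: low_polys2_coeff)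

lemma deriv_form_add: "deriv_form H (\<phi> + \<psi>) = deriv_form H \<phi> + deriv_form H \<psi>"
  by (simp add: deriv_form_def algebra_simps)

lemma log_pairs_add: "\<phi> \<in> log_pairs n A \<Longrightarrow> \<psi> \<in> log_pairs n A \<Longrightarrow> \<phi> + \<psi> \<in> log_pairs n A"
  by (simp add: log_pairs_def low_polys2_add deriv_form_add)

definition nodes :: "('a::field ^ 2) set set \<Rightarrow> ('a ^ 2) set \<Rightarrow> 'a set" where
  "nodes A H = {t. \<exists>H'\<in>A. param H t \<in> H'}"

locale arrangement_with_line =
  fixes A :: "('a::field ^ 2) set set" and H :: "('a ^ 2) set"
  assumes finite_A: "finite A"
    and lines_A: "H' \<in> A \<Longrightarrow> affine_line H'"
    and line_H: "affine_line H"
    and H_notin: "H \<notin> A"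
begin

abbreviation (input) rform :: "('a ^ 2) set \<Rightarrow> 'a poly" where
  "rform H' \<equiv> restr H (form H')"

text \<open>Zero if and only if \<open>H'\<close> is parallel to \<open>H\<close>.\<close>

definition slope :: "('a ^ 2) set \<Rightarrow> 'a" where
  "slope H' = coeff_x H' * coeff_y H - coeff_y H' * coeff_x H"

lemma rform_nonzero: "H' \<in> A \<Longrightarrow> rform H' \<noteq> 0"
  using restr_form_eq_0_iff[OF line_H lines_A] H_notin by auto

lemma rform_at_node:
  assumes "H' \<in> A" "param H t \<in> H'"
  shows "rform H' = smult (slope H') [:- t, 1:]" "slope H' \<noteq> 0"
proof -
  obtain a where r: "rform H' = [:a, slope H':]"
    by (simp add: form_def restr_lin slope_def)
  moreover have "poly (rform H') t = 0"
    using poly_restr_form[OF lines_A] assms by blast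
  ultimately have "a = - (slope H' * t)"
    by (simp add: eq_neg_iff_add_eq_0 mult.commute)
  with r show "rform H' = smult (slope H') [:- t, 1:]" by simp
  with rform_nonzero[OF assms(1)] show "slope H' \<noteq> 0" by auto
qed

lemma slope_nonzero_node:
  assumes "H' \<in> A" "slope H' \<noteq> 0"
  obtains t where "param H t \<in> H'"
proof -
  obtain a where r: "rform H' = [:a, slope H':]"
    by (simp add: form_def restr_lin slope_def)
  have "poly (rform H') (- a / slope H') = 0" using assms(2) by (simp add: r)
  then show ?thesis using that poly_restr_form[OF lines_A] assms(1) by blast
qed

lemma node_unique: "H' \<in> A \<Longrightarrow> param H s \<in> H' \<Longrightarrow> param H t \<in> H' \<Longrightarrow> s = t"
  using rform_at_node[of H' s] rform_at_node[of H' t] by auto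

definition thru :: "'a \<Rightarrow> ('a ^ 2) set set" where
  "thru t = {H' \<in> A. param H t \<in> H'}"

definition parallels :: "('a ^ 2) set set" where
  "parallels = {H' \<in> A. slope H' = 0}"

lemma finite_thru: "finite (thru t)"
  using finite_A by (simp add: thru_def)

lemma finite_parallels: "finite parallels"
  using finite_A by (simp add: parallels_def)

lemma finite_nodes: "finite (nodes A H)"
proof -
  have "nodes A H = (\<Union>H'\<in>A. {t. param H t \<in> H'})" by (auto simp: nodes_def)
  moreover have "finite {t. param H t \<in> H'}" if "H' \<in> A" for H'
  proof (cases "\<exists>s. param H s \<in> H'")
    case True
    then obtain s where "param H s \<in> H'" by blast
    then have "{t. param H t \<in> H'} \<subseteq> {s}" using node_unique that by blast
    then show ?thesis by (rule finite_subset) simp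
  qed simp
  ultimately show ?thesis using finite_A by simp
qed

lemma card_thru_pos: "t \<in> nodes A H \<Longrightarrow> 0 < card (thru t)"
  using finite_thru by (auto simp: card_gt_0_iff nodes_def thru_def)

lemma prod_split:
  "(\<Prod>H'\<in>A. f H') = (\<Prod>H'\<in>parallels. f H') * (\<Prod>t\<in>nodes A H. \<Prod>H'\<in>thru t. f H')"
proof -
  have "A = parallels \<union> (\<Union>t\<in>nodes A H. thru t)"
    using slope_nonzero_node by (auto simp: parallels_def thru_def nodes_def)
  moreover have "parallels \<inter> (\<Union>t\<in>nodes A H. thru t) = {}"
    using rform_at_node(2) by (auto simp: parallels_def thru_def)
  moreover have "(\<Prod>H'\<in>(\<Union>t\<in>nodes A H. thru t). f H') = (\<Prod>t\<in>nodes A H. \<Prod>H'\<in>thru t. f H')"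
    using finite_nodes finite_thru node_unique
    by (intro prod.UNION_disjoint) (auto simp: thru_def)
  ultimately show ?thesis
    using finite_parallels finite_nodes finite_thru by (metis prod.union_disjoint finite_UN)
qed

lemma card_split: "card A = card parallels + (\<Sum>t\<in>nodes A H. card (thru t))"
proof -
  have "(2::nat) ^ card A = 2 ^ (card parallels + (\<Sum>t\<in>nodes A H. card (thru t)))"
    using prod_split[of "\<lambda>_. 2::nat"] by (simp add: power_add power_sum)
  then show ?thesis by simp
qed

text \<open>The divisor of all restrictions of \<open>p f + q g\<close>: a point on \<open>m\<close> lines is a root of order \<open>m - 1\<close>.\<close>

definition node_poly :: "'a poly" where
  "node_poly = (\<Prod>t\<in>nodes A H. [:- t, 1:] ^ (card (thru t) - 1))"

lemma node_poly_nonzero: "node_poly \<noteq> 0"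
  using finite_nodes by (auto simp: node_poly_def)

lemma degree_node_poly: "degree node_poly + card (nodes A H) + card parallels = card A"
proof -
  have "degree node_poly = (\<Sum>t\<in>nodes A H. card (thru t) - 1)"
    unfolding node_poly_def by (subst degree_prod_eq_sum_degree) (auto simp: degree_power_eq)
  moreover have "(\<Sum>t\<in>nodes A H. card (thru t) - 1) + card (nodes A H) = (\<Sum>t\<in>nodes A H. card (thru t))"
  proof -
    have "(\<Sum>t\<in>nodes A H. card (thru t) - 1) + card (nodes A H) = (\<Sum>t\<in>nodes A H. card (thru t) - 1 + 1)"
      by (subst sum.distrib) simp
    also have "\<dots> = (\<Sum>t\<in>nodes A H. card (thru t))"
      using card_thru_pos by (intro sum.cong) force+
    finally show ?thesis .
  qed
  ultimately show ?thesis using card_split by simp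
qed

lemma card_nodes_le: "card (nodes A H) \<le> card A"
  using degree_node_poly by simp

lemma prod_rform:
  obtains c where "c \<noteq> 0"
    "(\<Prod>H'\<in>A. rform H') = smult c (node_poly * (\<Prod>t\<in>nodes A H. [:- t, 1:]))"
proof -
  define a where "a H' = coeff (rform H') 0" for H'
  have a: "rform H' = [:a H':]" "a H' \<noteq> 0" if "H' \<in> parallels" for H'
  proof -
    show "rform H' = [:a H':]"
      using that by (simp add: a_def parallels_def slope_def form_def restr_lin)
    then show "a H' \<noteq> 0" using rform_nonzero[of H'] that by (auto simp: parallels_def)
  qed
  define b where "b t = (\<Prod>H'\<in>thru t. slope H')" for t
  have b0: "b t \<noteq> 0" for t
    using finite_thru[of t] rform_at_node(2) by (auto simp: b_def thru_def)
  have thru: "(\<Prod>H'\<in>thru t. rform H') = smult (b t) ([:- t, 1:] ^ card (thru t))" for t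
  proof -
    have "(\<Prod>H'\<in>thru t. rform H') = (\<Prod>H'\<in>thru t. [:slope H':] * [:- t, 1:])"
      by (intro prod.cong) (auto simp: thru_def dest: rform_at_node(1))
    also have "\<dots> = (\<Prod>H'\<in>thru t. [:slope H':]) * [:- t, 1:] ^ card (thru t)"
      by (simp only: prod.distrib prod_constant)
    also have "(\<Prod>H'\<in>thru t. [:slope H':]) = [:b t:]"
      unfolding b_def using finite_thru[of t]
      by (induction rule: finite_induct) (simp_all add: one_pCons)
    finally show ?thesis by simp
  qed
  have "(\<Prod>H'\<in>parallels. rform H') = (\<Prod>H'\<in>parallels. [:a H':])"
    using a by (intro prod.cong) auto
  also have "\<dots> = [:\<Prod>H'\<in>parallels. a H':]"
    using finite_parallels by (induction rule: finite_induct) (simp_all add: one_pCons)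
  finally have par: "(\<Prod>H'\<in>parallels. rform H') = [:\<Prod>H'\<in>parallels. a H':]" .
  have "(\<Prod>t\<in>nodes A H. \<Prod>H'\<in>thru t. rform H')
      = (\<Prod>t\<in>nodes A H. [:b t:] * ([:- t, 1:] ^ (card (thru t) - 1) * [:- t, 1:]))"
  proof (intro prod.cong refl)
    fix t assume "t \<in> nodes A H"
    from card_thru_pos[OF this]
    have "[:- t, 1:] ^ (card (thru t) - 1) * [:- t, 1:] = [:- t, 1:] ^ card (thru t)"
      by (rule power_minus_mult)
    then show "(\<Prod>H'\<in>thru t. rform H') = [:b t:] * ([:- t, 1:] ^ (card (thru t) - 1) * [:- t, 1:])"
      unfolding thru by simp
  qed
  also have "\<dots> = (\<Prod>t\<in>nodes A H. [:b t:]) * (node_poly * (\<Prod>t\<in>nodes A H. [:- t, 1:]))"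
    by (simp only: prod.distrib node_poly_def)
  also have "(\<Prod>t\<in>nodes A H. [:b t:]) = [:\<Prod>t\<in>nodes A H. b t:]"
    using finite_nodes by (induction rule: finite_induct) (simp_all add: one_pCons)
  finally have "(\<Prod>H'\<in>A. rform H') =
    smult ((\<Prod>H'\<in>parallels. a H') * (\<Prod>t\<in>nodes A H. b t)) (node_poly * (\<Prod>t\<in>nodes A H. [:- t, 1:]))"
    unfolding prod_split par by simp
  moreover have "(\<Prod>H'\<in>parallels. a H') * (\<Prod>t\<in>nodes A H. b t) \<noteq> 0"
    using a(2) b0 finite_parallels finite_nodes by auto
  ultimately show ?thesis by (rule that[rotated])
qed

definition restr_deriv :: "'a poly2 \<times> 'a poly2 \<Rightarrow> 'a poly" where
  "restr_deriv \<phi> = restr H (deriv_form H \<phi>)"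

text \<open>At the point \<open>(c, e)\<close> compare \<open>(f, g)\<close> with the Euler derivation of that point: the determinant
  \<open>(x - c) g - (y - e) f\<close> is divisible by the form of every line of \<open>A\<close> through the point, and its restriction
  to \<open>H\<close> is that of \<open>p f + q g\<close> times the linear factor of the point.\<close>

lemma restr_deriv_node_dvd:
  assumes \<phi>: "\<phi> \<in> log_pairs n A"
  shows "[:- t, 1:] ^ card (thru t) dvd [:- t, 1:] * restr_deriv \<phi>"
proof -
  define X where "X = lin 1 0 (- (param H t $ 1))"
  define Y where "Y = lin 0 1 (- (param H t $ 2))"
  let ?f = "fst \<phi>" and ?g = "snd \<phi>"
  let ?F = "X * ?g - Y * ?f"
  have "form H' dvd ?F" if H': "H' \<in> thru t" for H'
  proof -
    have HA: "H' \<in> A" and on: "param H t \<in> H'" using H' by (auto simp: thru_def)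
    have "coeff_x H' * param H t $ 1 + coeff_y H' * param H t $ 2 + coeff_1 H' = 0"
      using mem_line_iff[OF lines_A[OF HA]] on by blast
    then have "coeff_1 H' = - (coeff_x H' * param H t $ 1) - coeff_y H' * param H t $ 2"
      by (simp add: algebra_simps eq_neg_iff_add_eq_0)
    then have form: "form H' = const2 (coeff_x H') * X + const2 (coeff_y H') * Y"
      by (simp add: form_def lin_def const2_def X_def Y_def)
    have d: "form H' dvd deriv_form H' \<phi>" using \<phi> HA by (simp add: log_pairs_def)
    have "const2 (coeff_x H') * ?F = form H' * ?g - Y * deriv_form H' \<phi>"
      by (simp add: form deriv_form_def algebra_simps)
    then have 1: "form H' dvd const2 (coeff_x H') * ?F" using d by simp
    have "const2 (coeff_y H') * ?F = X * deriv_form H' \<phi> - form H' * ?f"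
      by (simp add: form deriv_form_def algebra_simps)
    then have 2: "form H' dvd const2 (coeff_y H') * ?F" using d by simp
    show ?thesis using 1 2 line_coeffs(1)[OF lines_A[OF HA]] dvd_const2_mult_iff by blast
  qed
  then have "(\<Prod>H'\<in>thru t. form H') dvd ?F"
    using finite_thru lines_A by (intro prod_forms_dvd) (auto simp: thru_def)
  then have d1: "(\<Prod>H'\<in>thru t. rform H') dvd restr H ?F"
    using restr.hom_dvd[of "\<Prod>H'\<in>thru t. form H'" ?F H] by (simp add: restr.hom_prod)
  have "restr H X = smult (coeff_y H) [:- t, 1:]" "restr H Y = smult (- coeff_x H) [:- t, 1:]"
    by (simp_all add: X_def Y_def restr_lin param_nth)
  then have e: "restr H ?F = [:- t, 1:] * restr_deriv \<phi>"
    by (simp add: restr.hom_diff restr.hom_mult restr.hom_add restr_deriv_def deriv_form_def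
        algebra_simps smult_add_right)
  have d2: "[:- t, 1:] ^ card (thru t) dvd (\<Prod>H'\<in>thru t. rform H')"
    unfolding prod_constant[symmetric]
  proof (rule prod_dvd_prod)
    fix H' assume "H' \<in> thru t"
    then have "rform H' = smult (slope H') [:- t, 1:]" by (intro rform_at_node(1)) (auto simp: thru_def)
    then show "[:- t, 1:] dvd rform H'" by (simp only: dvd_smult dvd_refl)
  qed
  show ?thesis using dvd_trans[OF d2 d1] unfolding e .
qed

lemma node_poly_dvd: "\<phi> \<in> log_pairs n A \<Longrightarrow> node_poly dvd restr_deriv \<phi>"
  unfolding node_poly_def
proof (rule linear_powers_prod_dvd[OF finite_nodes])
  fix t assume \<phi>: "\<phi> \<in> log_pairs n A" and t: "t \<in> nodes A H"
  have "[:- t, 1:] * [:- t, 1:] ^ (card (thru t) - 1) = [:- t, 1:] ^ card (thru t)"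
    using power_minus_mult[OF card_thru_pos[OF t]] by (metis mult.commute)
  with restr_deriv_node_dvd[OF \<phi>, of t]
  have "[:- t, 1:] * [:- t, 1:] ^ (card (thru t) - 1) dvd [:- t, 1:] * restr_deriv \<phi>" by metis
  then show "[:- t, 1:] ^ (card (thru t) - 1) dvd restr_deriv \<phi>"
    by (metis dvd_mult_cancel_left pCons_eq_0_iff zero_neq_one)
qed

text \<open>The polynomial \<open>p f + q g\<close> is divisible by the forms of the lines parallel to \<open>H\<close>, and these are
  nonzero constants on \<open>H\<close>.\<close>

lemma restr_deriv_low:
  assumes \<phi>: "\<phi> \<in> log_pairs n A"
  shows "restr_deriv \<phi> \<in> low_polys (n - card parallels)"
proof -
  have "form H' dvd deriv_form H \<phi>" if H': "H' \<in> parallels" for H'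
  proof -
    have HA: "H' \<in> A" and par: "coeff_x H' * coeff_y H = coeff_y H' * coeff_x H"
      using H' by (auto simp: parallels_def slope_def)
    from proportional_coeffs[OF line_coeffs(1)[OF line_H], of 0 0 0 "coeff_x H'" "coeff_y H'" 0] par
    obtain c where c: "coeff_x H' = c * coeff_x H" "coeff_y H' = c * coeff_y H" by auto
    then have "c \<noteq> 0" using line_coeffs(1)[OF lines_A[OF HA]] by auto
    have "deriv_form H' \<phi> = const2 c * deriv_form H \<phi>"
      by (simp add: deriv_form_def c const2.hom_mult algebra_simps)
    moreover have "form H' dvd deriv_form H' \<phi>" using \<phi> HA by (simp add: log_pairs_def)
    ultimately show ?thesis using dvd_const2_mult_iff[OF \<open>c \<noteq> 0\<close>] by simp
  qed
  then have "(\<Prod>H'\<in>parallels. form H') dvd deriv_form H \<phi>"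
    using finite_parallels lines_A by (intro prod_forms_dvd) (auto simp: parallels_def)
  then obtain G where G: "deriv_form H \<phi> = (\<Prod>H'\<in>parallels. form H') * G" by (elim dvdE)
  have P0: "(\<Prod>H'\<in>parallels. form H') \<noteq> 0"
    using finite_parallels lines_A form_nonzero by (auto simp: parallels_def)
  have "tdeg (\<Prod>H'\<in>parallels. form H') = card parallels"
    using finite_parallels lines_A by (intro tdeg_prod_forms) (auto simp: parallels_def)
  then have "G \<in> low_polys2 (n - card parallels)"
    using low_polys2_mult_cancel[OF _ P0, of G n] deriv_form_low_polys2[OF \<phi>, of H] G by simp
  then have g: "restr H G \<in> low_polys (n - card parallels)" by (rule restr_low_polys)
  have "degree (\<Prod>H'\<in>parallels. rform H') \<le> (\<Sum>H'\<in>parallels. degree (rform H'))"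
    using degree_prod_sum_le[OF finite_parallels, of "\<lambda>H'. restr H (form H')"] by (simp add: o_def)
  also have "\<dots> = 0"
    by (rule sum.neutral) (auto simp: parallels_def slope_def form_def restr_lin)
  finally have "degree (\<Prod>H'\<in>parallels. rform H') \<le> 0" .
  from low_polys_mult[OF this g] show ?thesis
    by (simp add: restr_deriv_def G restr.hom_mult restr.hom_prod)
qed

theorem restr_deriv_image_subset:
  assumes \<phi>: "\<phi> \<in> log_pairs n A"
  shows "restr_deriv \<phi> \<in> (*) node_poly ` low_polys (n - (card A - card (nodes A H)))"
proof -
  obtain g where g: "restr_deriv \<phi> = node_poly * g"
    using node_poly_dvd[OF \<phi>] by (elim dvdE)
  have "g \<in> low_polys (n - card parallels - degree node_poly)"
    using low_polys_mult_cancel[OF _ node_poly_nonzero] restr_deriv_low[OF \<phi>] g by metis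
  moreover have "n - card parallels - degree node_poly = n - (card A - card (nodes A H))"
    using degree_node_poly by linarith
  ultimately show ?thesis using g by auto
qed

text \<open>Multiplying a constant direction \<open>(u, v)\<close> by the forms of all lines of \<open>A\<close>, except some which have this
  direction, gives a logarithmic pair.\<close>

lemma log_pairs_mult_forms:
  assumes B: "B \<subseteq> A" "\<And>H'. H' \<in> A - B \<Longrightarrow> coeff_x H' * u + coeff_y H' * v = 0"
    and h: "h \<in> low_polys2 m" and n: "card B + m \<le> n"
  shows "((\<Prod>H'\<in>B. form H') * h * const2 u, (\<Prod>H'\<in>B. form H') * h * const2 v) \<in> log_pairs n A"
    (is "?\<phi> \<in> _")
proof -
  have fB: "finite B" by (rule finite_subset[OF B(1) finite_A])
  have "tdeg (\<Prod>H'\<in>B. form H') = card B"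
    using fB B lines_A by (intro tdeg_prod_forms) auto
  then have "(\<Prod>H'\<in>B. form H') * h \<in> low_polys2 (card B + m)"
    by (intro low_polys2_mult[OF _ h]) simp
  then have Fh: "(\<Prod>H'\<in>B. form H') * h \<in> low_polys2 n"
    using low_polys2_mono[OF n] by (rule subsetD[rotated])
  have low: "(\<Prod>H'\<in>B. form H') * h * const2 c \<in> low_polys2 n" for c
    using low_polys2_mult[OF _ Fh, of "const2 c" 0] by (simp add: mult.commute)
  have d: "deriv_form H' ?\<phi> = (\<Prod>H'\<in>B. form H') * h * const2 (coeff_x H' * u + coeff_y H' * v)" for H'
    by (simp add: deriv_form_def const2.hom_add const2.hom_mult algebra_simps)
  have "form H' dvd deriv_form H' ?\<phi>" if "H' \<in> A" for H'
  proof (cases "H' \<in> B")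
    case True
    then show ?thesis unfolding d using fB by (simp add: dvd_prodI)
  next
    case False
    then show ?thesis unfolding d using B(2) that by (simp add: const2.hom_0)
  qed
  then show ?thesis using low by (simp add: log_pairs_def)
qed

lemma restr_deriv_add: "restr_deriv (\<phi> + \<psi>) = restr_deriv \<phi> + restr_deriv \<psi>"
  by (simp add: restr_deriv_def deriv_form_add restr.hom_add)

text \<open>If \<open>A\<close> meets \<open>H\<close>, take for each point of intersection a line \<open>J\<close> of \<open>A\<close> through it, and multiply the
  direction of \<open>J\<close> by the forms of the other lines. The restriction is \<open>node_poly\<close> times the product of
  the linear factors of the other points, and these products span by \<open>lagrange_span\<close>. If all lines of
  \<open>A\<close> are parallel to \<open>H\<close>, a direction transversal to \<open>H\<close> times all forms does.\<close>

theorem restr_deriv_image_supset: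
  assumes n: "card A \<le> n" and g: "g \<in> low_polys (n - (card A - card (nodes A H)))"
  shows "node_poly * g \<in> restr_deriv ` log_pairs n A"
proof (cases "nodes A H = {}")
  case True
  obtain c where c: "c \<noteq> 0" "(\<Prod>H'\<in>A. rform H') = [:c:]"
    using prod_rform True by (auto simp: node_poly_def)
  obtain u v where uv: "coeff_x H * u + coeff_y H * v = 1"
  proof (cases "coeff_x H = 0")
    case True
    then show ?thesis using that[of 0 "1 / coeff_y H"] line_coeffs(1)[OF line_H] by simp
  next
    case False
    then show ?thesis using that[of "1 / coeff_x H" 0] by simp
  qed
  have "smult (1 / c) g \<in> low_polys (n - card A)" using g True by (simp add: low_polys_def)
  from restr_surj[OF line_H this] obtain h
    where h: "h \<in> low_polys2 (n - card A)" "restr H h = smult (1 / c) g" by blast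
  let ?\<phi> = "((\<Prod>H'\<in>A. form H') * h * const2 u, (\<Prod>H'\<in>A. form H') * h * const2 v)"
  have "?\<phi> \<in> log_pairs n A"
    using log_pairs_mult_forms[of A u v h] h(1) n by simp
  moreover have "deriv_form H ?\<phi> = (\<Prod>H'\<in>A. form H') * h * const2 (coeff_x H * u + coeff_y H * v)"
    by (simp add: deriv_form_def const2.hom_add const2.hom_mult algebra_simps)
  then have "restr_deriv ?\<phi> = node_poly * g"
    using c h(2) True by (simp add: restr_deriv_def uv restr.hom_mult restr.hom_prod node_poly_def const2.hom_1)
  ultimately show ?thesis by (metis imageI)
next
  case False
  define S where "S = {u. node_poly * u \<in> restr_deriv ` log_pairs n A}"
  have "g \<in> S"
  proof (rule lagrange_span[OF finite_nodes False])
    show "0 < n - card A + 1" by simp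
    have "n - (card A - card (nodes A H)) = n - card A + 1 + card (nodes A H) - 1"
      using n card_nodes_le by simp
    then show "g \<in> low_polys (n - card A + 1 + card (nodes A H) - 1)" using g by simp
    show "u + v \<in> S" if "u \<in> S" "v \<in> S" for u v
    proof -
      from that obtain \<phi> \<psi> where "\<phi> \<in> log_pairs n A" "\<psi> \<in> log_pairs n A"
        "node_poly * u = restr_deriv \<phi>" "node_poly * v = restr_deriv \<psi>"
        by (auto simp: S_def)
      then show ?thesis
        by (auto simp: S_def distrib_left restr_deriv_add[symmetric] intro: log_pairs_add)
    qed
    fix t and s :: "'a poly" assume t: "t \<in> nodes A H" and s: "s \<in> low_polys (n - card A + 1)"
    let ?T = "\<Prod>t\<in>nodes A H - {t}. [:- t, 1:]"
    obtain J where J: "J \<in> A" "param H t \<in> J" using t by (auto simp: nodes_def)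
    note rform_J = rform_at_node[OF J]
    let ?P = "\<Prod>H'\<in>A - {J}. rform H'"
    obtain c where c: "c \<noteq> 0" "(\<Prod>H'\<in>A. rform H') = smult c (node_poly * (\<Prod>t\<in>nodes A H. [:- t, 1:]))"
      by (rule prod_rform)
    \<comment> \<open>Cancel the linear factor of the point from the factorization of the product of all forms.\<close>
    have "(\<Prod>H'\<in>A. rform H') = rform J * ?P" using prod.remove[OF finite_A J(1)] .
    moreover have "(\<Prod>t\<in>nodes A H. [:- t, 1:]) = [:- t, 1:] * ?T"
      using prod.remove[OF finite_nodes t] .
    ultimately have "[:- t, 1:] * smult (slope J) ?P = [:- t, 1:] * smult c (node_poly * ?T)"
      using c(2) rform_J(1) by (simp add: mult_smult_left mult_smult_right mult.left_commute del: mult_pCons_left smult_pCons)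
    moreover have "[:- t, 1:] \<noteq> 0" by simp
    ultimately have P: "smult (slope J) ?P = smult c (node_poly * ?T)"
      using mult_left_cancel by blast
    have "smult (- 1 / c) s \<in> low_polys (n - card A + 1)" using s by (simp add: low_polys_def)
    from restr_surj[OF line_H this] obtain h
      where h: "h \<in> low_polys2 (n - card A + 1)" "restr H h = smult (- 1 / c) s" by blast
    let ?F = "\<Prod>H'\<in>A - {J}. form H'"
    let ?\<phi> = "(?F * h * const2 (coeff_y J), ?F * h * const2 (- coeff_x J))"
    have "card (A - {J}) + (n - card A + 1) \<le> n"
      using card_Suc_Diff1[OF finite_A J(1)] n by linarith
    then have "?\<phi> \<in> log_pairs n A"
      using h(1) J(1) by (intro log_pairs_mult_forms) auto
    moreover have "deriv_form H ?\<phi> = ?F * h * const2 (- slope J)"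
      by (simp add: deriv_form_def const2.hom_add const2.hom_mult slope_def const2.hom_diff const2.hom_uminus algebra_simps)
    then have "restr_deriv ?\<phi> = ?P * smult (- 1 / c) s * [:- slope J:]"
      by (simp add: restr_deriv_def restr.hom_mult restr.hom_prod h(2))
    then have "restr_deriv ?\<phi> = smult (1 / c) (smult (slope J) ?P * s)" by simp
    then have "restr_deriv ?\<phi> = node_poly * (s * ?T)"
      unfolding P using c(1) by (simp add: mult_ac)
    ultimately show "s * ?T \<in> S" unfolding S_def mem_Collect_eq by (intro image_eqI) simp_all
  qed
  then show ?thesis by (simp add: S_def)
qed

lemma log_pairs_insert: "log_pairs n (insert H A) = {\<phi> \<in> log_pairs n A. restr_deriv \<phi> = 0}"
  by (auto simp: log_pairs_def restr_deriv_def restr_eq_0_iff[OF line_H])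

theorem has_dim_log_pairs_insert:
  assumes n: "card A \<le> n" and m: "pairs.has_dim (log_pairs n A) m"
  shows "n - (card A - card (nodes A H)) \<le> m"
    "pairs.has_dim (log_pairs n (insert H A)) (m - (n - (card A - card (nodes A H))))"
proof -
  let ?k = "n - (card A - card (nodes A H))"
  have lin: "Vector_Spaces.linear scale_pair smult restr_deriv"
    by unfold_locales
      (simp_all add: restr_deriv_add, simp add: restr_deriv_def deriv_form_def scale_pair_def
        restr.hom_add restr.hom_mult smult_add_right mult.commute)
  have "Vector_Spaces.linear smult smult ((*) node_poly)"
    by unfold_locales (simp_all add: algebra_simps)
  from poly1_poly1.has_dim_injective_image[OF this has_dim_low_polys[of ?k]]
  have "poly1.has_dim ((*) node_poly ` low_polys ?k) ?k"
    using node_poly_nonzero by simp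
  moreover have "(*) node_poly ` low_polys ?k = restr_deriv ` log_pairs n A"
    using restr_deriv_image_subset restr_deriv_image_supset[OF n] by blast
  ultimately have "poly1.has_dim (restr_deriv ` log_pairs n A) ?k" by simp
  from pairs_poly1.has_dim_kernel[OF lin m this]
  show "?k \<le> m" "pairs.has_dim (log_pairs n (insert H A)) (m - ?k)"
    by (simp_all add: log_pairs_insert)
qed

lemma restr_deriv_eq_0:
  assumes "\<phi> \<in> log_pairs n A" "n \<le> card A - card (nodes A H)"
  shows "form H dvd deriv_form H \<phi>"
proof -
  have "restr_deriv \<phi> = 0"
    using restr_deriv_image_subset[OF assms(1)] assms(2) by (auto simp: low_polys_iff)
  then show ?thesis by (simp add: restr_deriv_def restr_eq_0_iff[OF line_H])
qed

text \<open>At a point of intersection with \<open>J\<close>, a pair tangent to both \<open>H\<close> and \<open>J\<close> is zero, so the components have at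
  least \<open>k\<close> zeros on \<open>H\<close> but degree less than \<open>k\<close>.\<close>

lemma form_dvd_components:
  assumes \<phi>: "\<phi> \<in> log_pairs n A" and n: "n \<le> card (nodes A H)" and H: "form H dvd deriv_form H \<phi>"
  shows "form H dvd fst \<phi>" "form H dvd snd \<phi>"
proof -
  let ?f = "restr H (fst \<phi>)" and ?g = "restr H (snd \<phi>)"
  have dH: "smult (coeff_x H) ?f + smult (coeff_y H) ?g = 0"
    using H by (simp add: restr_eq_0_iff[OF line_H, symmetric] deriv_form_def restr.hom_add restr.hom_mult)
  have roots: "poly ?f t = 0 \<and> poly ?g t = 0" if t: "t \<in> nodes A H" for t
  proof -
    obtain J where J: "J \<in> A" "param H t \<in> J" using t by (auto simp: nodes_def)
    have "rform J dvd restr H (deriv_form J \<phi>)"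
      using \<phi> J(1) by (intro restr.hom_dvd) (simp add: log_pairs_def)
    moreover have "poly (rform J) t = 0" using rform_at_node(1)[OF J] by simp
    ultimately have "poly (restr H (deriv_form J \<phi>)) t = 0" by (auto elim!: dvdE)
    then have 1: "coeff_x J * poly ?f t + coeff_y J * poly ?g t = 0"
      by (simp add: deriv_form_def restr.hom_add restr.hom_mult)
    have 2: "coeff_x H * poly ?f t + coeff_y H * poly ?g t = 0"
      using arg_cong[OF dH, of "\<lambda>p. poly p t"] by simp
    have "slope J * poly ?f t = coeff_y H * (coeff_x J * poly ?f t + coeff_y J * poly ?g t)
        - coeff_y J * (coeff_x H * poly ?f t + coeff_y H * poly ?g t)"
      by (simp add: slope_def algebra_simps)
    moreover have "slope J * poly ?g t = coeff_x J * (coeff_x H * poly ?f t + coeff_y H * poly ?g t)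
        - coeff_x H * (coeff_x J * poly ?f t + coeff_y J * poly ?g t)"
      by (simp add: slope_def algebra_simps)
    ultimately have "slope J * poly ?f t = 0" "slope J * poly ?g t = 0"
      by (simp_all only: 1 2 mult_zero_right diff_self)
    then show ?thesis using rform_at_node(2)[OF J] by simp
  qed
  have zero: "q = 0" if low: "q \<in> low_polys n" and q: "\<And>t. t \<in> nodes A H \<Longrightarrow> poly q t = 0" for q
  proof (rule ccontr)
    assume "q \<noteq> 0"
    then have "card (nodes A H) \<le> card {t. poly q t = 0}"
      using q by (intro card_mono poly_roots_finite) auto
    also have "\<dots> \<le> degree q" using card_poly_roots_bound \<open>q \<noteq> 0\<close> by blast
    also have "\<dots> < n" using low \<open>q \<noteq> 0\<close> by (simp add: low_polys_iff)
    finally show False using n by simp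
  qed
  have "?f \<in> low_polys n" "?g \<in> low_polys n"
    using \<phi> by (auto simp: log_pairs_def intro: restr_low_polys)
  then have "?f = 0" "?g = 0" using zero roots by simp_all
  then show "form H dvd fst \<phi>" "form H dvd snd \<phi>" by (simp_all add: restr_eq_0_iff[OF line_H])
qed

end

section \<open>Counting points\<close>

lemma arrangement_with_line_Diff:
  "line_arrangement C \<Longrightarrow> affine_line H \<Longrightarrow> arrangement_with_line (C - {H}) H"
  by unfold_locales (auto simp: line_arrangement_def)

lemma lines_meet_once:
  assumes "affine_line H" "affine_line H'" "H \<noteq> H'" "u \<in> H" "v \<in> H" "u \<in> H'" "v \<in> H'"
  shows "u = v"
proof -
  interpret arrangement_with_line "{H'}" H
    using assms by unfold_locales auto
  from param_surj[OF assms(1,4)] obtain s where s: "u = param H s" .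
  from param_surj[OF assms(1,5)] obtain t where t: "v = param H t" .
  show ?thesis using node_unique[of H' s t] assms s t by simp
qed

lemma two_points_on_line:
  assumes "affine_line H"
  obtains u v where "u \<in> H" "v \<in> H" "u \<noteq> v"
  using that[of "param H 0" "param H 1"] param_mem[OF assms] inj_param[OF assms]
  by (simp add: inj_eq)

lemma line_not_subset: "affine_line H \<Longrightarrow> affine_line H' \<Longrightarrow> H \<subseteq> H' \<Longrightarrow> H = H'"
  by (metis lines_meet_once subsetD two_points_on_line)

lemma line_neq_UNIV:
  assumes "affine_line (H :: ('a::field ^ 2) set)"
  shows "H \<noteq> UNIV"
proof
  assume H: "H = UNIV"
  have eq: "coeff_x H * a + coeff_y H * b + coeff_1 H = 0" for a b
  proof -
    have "(vector [a, b] :: 'a ^ 2) \<in> H" using H by simp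
    then show ?thesis using mem_line_iff[OF assms] by simp
  qed
  have "coeff_x H = 0" using eq[of 1 0] eq[of 0 0] by simp
  moreover have "coeff_y H = 0" using eq[of 0 1] eq[of 0 0] by simp
  ultimately show False using line_coeffs(1)[OF assms] by simp
qed

lemma card_points_on:
  assumes C: "line_arrangement C" and H: "affine_line H"
  shows "card (points_on C H) = card (nodes (C - {H}) H)"
proof -
  have lines: "affine_line H'" if "H' \<in> C" for H' using C that by (simp add: line_arrangement_def)
  have single: "H \<inter> H' = {v}" if "H' \<in> C" "H' \<noteq> H" "v \<in> H" "v \<in> H'" for H' v
    using lines_meet_once[OF H lines[OF that(1)]] that by blast
  have "points_on C H = (\<lambda>t. {param H t}) ` nodes (C - {H}) H"
  proof (intro equalityI subsetI)
    fix X assume "X \<in> points_on C H"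
    then obtain H' where H': "X = H \<inter> H'" "H' \<in> C" "H' \<noteq> H" "X \<noteq> {}"
      by (auto simp: points_on_def)
    then obtain v where v: "v \<in> H" "v \<in> H'" by blast
    from param_surj[OF H v(1)] obtain t where t: "v = param H t" .
    then have "t \<in> nodes (C - {H}) H" using H' v by (auto simp: nodes_def)
    moreover have "X = {param H t}" using single[OF H'(2,3) v] H'(1) t by simp
    ultimately show "X \<in> (\<lambda>t. {param H t}) ` nodes (C - {H}) H" by blast
  next
    fix X assume "X \<in> (\<lambda>t. {param H t}) ` nodes (C - {H}) H"
    then obtain t H' where t: "X = {param H t}" "H' \<in> C" "H' \<noteq> H" "param H t \<in> H'"
      by (auto simp: nodes_def)
    then have "X = H \<inter> H'" using single[OF t(2,3) param_mem[OF H] t(4)] by simp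
    then show "X \<in> points_on C H" using t by (auto simp: points_on_def)
  qed
  moreover have "inj_on (\<lambda>t. {param H t}) (nodes (C - {H}) H)"
    using inj_param[OF H] by (auto simp: inj_on_def)
  ultimately show ?thesis by (simp add: card_image)
qed

definition multiplicity_at :: "('a::field ^ 2) set set \<Rightarrow> 'a ^ 2 \<Rightarrow> nat" where
  "multiplicity_at C v = card {H \<in> C. v \<in> H}"

definition crossings :: "('a::field ^ 2) set set \<Rightarrow> ('a ^ 2) set" where
  "crossings C = {v. 2 \<le> multiplicity_at C v}"

text \<open>The constant coefficient of the characteristic polynomial (\<open>char_poly_eq\<close>).\<close>

definition second_betti :: "('a::field ^ 2) set set \<Rightarrow> nat" where
  "second_betti C = (\<Sum>v\<in>crossings C. multiplicity_at C v - 1)"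

lemma crossing_two_lines:
  assumes "finite C" "v \<in> crossings C"
  obtains H H' where "H \<in> C" "H' \<in> C" "H \<noteq> H'" "v \<in> H" "v \<in> H'"
proof -
  have "\<not> card {H \<in> C. v \<in> H} \<le> 1"
    using assms(2) by (simp add: crossings_def multiplicity_at_def)
  then show ?thesis using assms(1) that by (auto simp: card_le_Suc0_iff_eq)
qed

lemma two_lines_crossing:
  assumes "finite C" "H \<in> C" "H' \<in> C" "H \<noteq> H'" "v \<in> H" "v \<in> H'"
  shows "v \<in> crossings C"
proof -
  have "card {H, H'} \<le> card {H \<in> C. v \<in> H}"
    using assms by (intro card_mono) auto
  then show ?thesis using assms(4) by (simp add: crossings_def multiplicity_at_def)
qed

lemma finite_crossings:
  assumes C: "line_arrangement C"
  shows "finite (crossings C)"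
proof -
  have fin: "finite C" using C by (simp add: line_arrangement_def)
  have "crossings C \<subseteq> (\<Union>H\<in>C. param H ` nodes (C - {H}) H)"
  proof
    fix v assume "v \<in> crossings C"
    from crossing_two_lines[OF fin this] obtain H H'
      where H: "H \<in> C" "H' \<in> C" "H \<noteq> H'" "v \<in> H" "v \<in> H'" .
    have "affine_line H" using C H(1) by (simp add: line_arrangement_def)
    from param_surj[OF this H(4)] obtain t where "v = param H t" .
    then show "v \<in> (\<Union>H\<in>C. param H ` nodes (C - {H}) H)"
      using H by (auto simp: nodes_def)
  qed
  moreover have "finite (param H ` nodes (C - {H}) H)" if "H \<in> C" for H
  proof -
    have "affine_line H" using C that by (simp add: line_arrangement_def)
    then show ?thesis
      using arrangement_with_line.finite_nodes[OF arrangement_with_line_Diff[OF C]] by simp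
  qed
  ultimately show ?thesis using fin finite_subset by blast
qed

context arrangement_with_line
begin

text \<open>A further line raises by one the multiplicity of each point in which it meets \<open>A\<close>.\<close>

lemma second_betti_insert: "second_betti (insert H A) = second_betti A + card (nodes A H)"
proof -
  let ?P = "crossings (insert H A)"
  have arr: "line_arrangement (insert H A)"
    using finite_A lines_A line_H by (simp add: line_arrangement_def)
  have fP: "finite ?P" by (rule finite_crossings[OF arr])
  have mult: "multiplicity_at (insert H A) v = multiplicity_at A v + (if v \<in> H then 1 else 0)" for v
  proof (cases "v \<in> H")
    case True
    then have "{H' \<in> insert H A. v \<in> H'} = insert H {H' \<in> A. v \<in> H'}" by auto
    then show ?thesis using True H_notin finite_A by (simp add: multiplicity_at_def)
  next
    case False
    then have "{H' \<in> insert H A. v \<in> H'} = {H' \<in> A. v \<in> H'}" by auto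
    then show ?thesis using False by (simp add: multiplicity_at_def)
  qed
  have sub: "crossings A \<subseteq> ?P" by (auto simp: crossings_def mult)
  have "second_betti A = (\<Sum>v\<in>?P. multiplicity_at A v - 1)"
    unfolding second_betti_def using fP sub by (rule sum.mono_neutral_left) (auto simp: crossings_def)
  moreover have "second_betti (insert H A) =
      (\<Sum>v\<in>?P. (multiplicity_at A v - 1) + (if v \<in> H \<and> 1 \<le> multiplicity_at A v then 1 else 0))"
    unfolding second_betti_def by (rule sum.cong) (auto simp: mult crossings_def)
  moreover have "{v \<in> ?P. v \<in> H \<and> 1 \<le> multiplicity_at A v} = param H ` nodes A H"
  proof (intro equalityI subsetI)
    fix v assume "v \<in> {v \<in> ?P. v \<in> H \<and> 1 \<le> multiplicity_at A v}"
    then have v: "v \<in> H" and m: "card {H' \<in> A. v \<in> H'} \<noteq> 0" by (auto simp: multiplicity_at_def)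
    then have "{H' \<in> A. v \<in> H'} \<noteq> {}" by (metis card.empty)
    then obtain H' where "H' \<in> A" "v \<in> H'" by blast
    moreover from param_surj[OF line_H v] obtain t where "v = param H t" .
    ultimately show "v \<in> param H ` nodes A H" by (auto simp: nodes_def)
  next
    fix v assume "v \<in> param H ` nodes A H"
    then obtain t H' where t: "v = param H t" "H' \<in> A" "v \<in> H'" by (auto simp: nodes_def)
    then have v: "v \<in> H" using param_mem[OF line_H] by simp
    have "0 < multiplicity_at A v"
      using t finite_A by (auto simp: multiplicity_at_def card_gt_0_iff)
    then show "v \<in> {v \<in> ?P. v \<in> H \<and> 1 \<le> multiplicity_at A v}"
      using v by (simp add: crossings_def mult)
  qed
  then have "card {v \<in> ?P. v \<in> H \<and> 1 \<le> multiplicity_at A v} = card (nodes A H)"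
    using inj_param[OF line_H] by (simp add: card_image inj_on_subset)
  then have "(\<Sum>v\<in>?P. if v \<in> H \<and> 1 \<le> multiplicity_at A v then 1 else 0 :: nat) = card (nodes A H)"
    using fP by (simp add: sum.inter_filter[symmetric])
  ultimately show ?thesis by (simp add: sum.distrib)
qed

end

text \<open>Each new line lowers the dimension by \<open>n - (card A - k)\<close>, and by \<open>second_betti_insert\<close> the numbers \<open>k\<close>
  sum to \<open>second_betti C\<close>.\<close>

theorem has_dim_log_pairs:
  assumes "line_arrangement (C :: ('a::field ^ 2) set set)" "card C \<le> n"
  obtains m where "pairs.has_dim (log_pairs n C) m"
    "2 * int m = 2 * int n * (int n + 1) - 2 * int (card C) * int n
      + int (card C) * (int (card C) - 1) - 2 * int (second_betti C)"
proof -
  have "finite C" using assms(1) by (simp add: line_arrangement_def)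
  then have "line_arrangement C \<Longrightarrow> card C \<le> n \<Longrightarrow> \<exists>m. pairs.has_dim (log_pairs n C) m \<and>
    2 * int m = 2 * int n * (int n + 1) - 2 * int (card C) * int n
      + int (card C) * (int (card C) - 1) - 2 * int (second_betti C)"
  proof (induction C rule: finite_induct)
    case empty
    let ?h = "n * (n + 1) div 2"
    have "log_pairs n {} = low_polys2 n \<times> (low_polys2 n :: 'a poly2 set)"
      by (auto simp: log_pairs_def)
    then have "pairs.has_dim (log_pairs n ({} :: ('a ^ 2) set set)) (?h + ?h)"
      using has_dim_Times[OF has_dim_low_polys2 has_dim_low_polys2, of n n, where 'a='a] by simp
    moreover have "2 * (?h + ?h) = 2 * n * (n + 1)" by simp
    then have "int (2 * (?h + ?h)) = int (2 * n * (n + 1))" by (simp only:)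
    then have "2 * int (?h + ?h) = 2 * int n * (int n + 1)"
      by (simp only: of_nat_1 of_nat_add of_nat_mult of_nat_numeral)
    moreover have "second_betti ({} :: ('a ^ 2) set set) = 0"
      by (simp add: second_betti_def crossings_def multiplicity_at_def)
    ultimately show ?case by (intro exI[of _ "?h + ?h"]) simp
  next
    case (insert H A)
    interpret arrangement_with_line A H
      using insert by unfold_locales (auto simp: line_arrangement_def)
    have A: "line_arrangement A" "card A \<le> n"
      using insert by (auto simp: line_arrangement_def)
    from insert.IH[OF this] obtain m where m: "pairs.has_dim (log_pairs n A) m"
      "2 * int m = 2 * int n * (int n + 1) - 2 * int (card A) * int n
        + int (card A) * (int (card A) - 1) - 2 * int (second_betti A)" by blast
    let ?k = "n - (card A - card (nodes A H))"
    note dims = has_dim_log_pairs_insert[OF A(2) m(1)]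
    have k: "int ?k = int n - int (card A) + int (card (nodes A H))"
      using A(2) card_nodes_le by simp
    have "2 * int (m - ?k) = 2 * int m - 2 * int ?k" using dims(1) by (simp add: of_nat_diff)
    also have "\<dots> = 2 * int n * (int n + 1) - 2 * int (card (insert H A)) * int n
        + int (card (insert H A)) * (int (card (insert H A)) - 1) - 2 * int (second_betti (insert H A))"
      unfolding k m(2) second_betti_insert using insert.hyps by (simp add: algebra_simps)
    finally show ?case using dims(2) by blast
  qed
  then show ?thesis using assms that by blast
qed

section \<open>The characteristic polynomial\<close>

lemma intersection_poset_eq:
  assumes C: "line_arrangement C"
  shows "intersection_poset C = insert UNIV (C \<union> (\<lambda>v. {v}) ` crossings C)"
proof -
  have fin: "finite C" and lines: "\<And>H. H \<in> C \<Longrightarrow> affine_line H"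
    using C by (auto simp: line_arrangement_def)
  show ?thesis
  proof (intro equalityI subsetI)
    fix X assume "X \<in> intersection_poset C"
    then obtain B where B: "X = \<Inter>B" "B \<subseteq> C" "X \<noteq> {}" by (auto simp: intersection_poset_def)
    show "X \<in> insert UNIV (C \<union> (\<lambda>v. {v}) ` crossings C)"
    proof (cases "\<exists>H\<in>B. \<exists>H'\<in>B. H \<noteq> H'")
      case True
      then obtain H H' where H: "H \<in> B" "H' \<in> B" "H \<noteq> H'" by blast
      obtain v where v: "v \<in> X" using B(3) by blast
      have "X \<subseteq> {v}"
        using lines_meet_once[OF lines lines, of H H' _ v] H B(1,2) v by blast
      then have "X = {v}" using v by blast
      moreover have "v \<in> crossings C"
        using two_lines_crossing[OF fin, of H H' v] H B v by blast
      ultimately show ?thesis by blast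
    next
      case False
      show ?thesis
      proof (cases "B = {}")
        case False
        then obtain H where "H \<in> B" by blast
        with \<open>\<not> (\<exists>H\<in>B. \<exists>H'\<in>B. H \<noteq> H')\<close> have "B = {H}" by blast
        then show ?thesis using B by simp
      qed (use B in simp)
    qed
  next
    fix X assume X: "X \<in> insert UNIV (C \<union> (\<lambda>v. {v}) ` crossings C)"
    consider "X = UNIV" | "X \<in> C" | v where "v \<in> crossings C" "X = {v}" using X by blast
    then show "X \<in> intersection_poset C"
    proof cases
      case 1
      then show ?thesis by (auto simp: intersection_poset_def intro!: exI[of _ "{}"])
    next
      case 2
      then have "X \<noteq> {}" using two_points_on_line[OF lines] by blast
      with 2 show ?thesis by (auto simp: intersection_poset_def intro!: exI[of _ "{X}"])
    next
      case 3
      from crossing_two_lines[OF fin 3(1)] obtain H H'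
        where H: "H \<in> C" "H' \<in> C" "H \<noteq> H'" "v \<in> H" "v \<in> H'" .
      have "u = v" if "u \<in> H" "u \<in> H'" for u
        using lines_meet_once[OF lines lines, of H H' u v] H that by blast
      then have "\<Inter>{H \<in> C. v \<in> H} = {v}" using H by blast
      then have "\<exists>B. {v} = \<Inter>B \<and> B \<subseteq> C" by (intro exI[of _ "{H \<in> C. v \<in> H}"]) auto
      then show ?thesis using 3(2) by (simp add: intersection_poset_def)
    qed
  qed
qed

lemma mu_UNIV: "finite C \<Longrightarrow> mu C UNIV = 1"
  by (simp add: mu.simps)

lemma mu_line:
  assumes C: "line_arrangement C" and H: "H \<in> C"
  shows "mu C H = - 1"
proof -
  have fin: "finite C" and lines: "\<And>H. H \<in> C \<Longrightarrow> affine_line H"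
    using C by (auto simp: line_arrangement_def)
  have "{Y \<in> intersection_poset C. H \<subset> Y} = {UNIV}"
  proof (intro equalityI subsetI)
    fix Y assume Y: "Y \<in> {Y \<in> intersection_poset C. H \<subset> Y}"
    obtain u v where uv: "u \<in> H" "v \<in> H" "u \<noteq> v" using two_points_on_line[OF lines[OF H]] .
    have "Y \<notin> C" using line_not_subset[OF lines lines, of H Y] H Y by blast
    moreover have "Y \<noteq> {w}" for w using uv Y by blast
    ultimately show "Y \<in> {UNIV}" using Y by (auto simp: intersection_poset_eq[OF C])
  next
    fix Y assume "Y \<in> {UNIV :: ('a ^ 2) set}"
    then show "Y \<in> {Y \<in> intersection_poset C. H \<subset> Y}"
      using line_neq_UNIV[OF lines[OF H]] by (auto simp: intersection_poset_eq[OF C])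
  qed
  then show ?thesis
    using line_neq_UNIV[OF lines[OF H]] fin by (subst mu.simps) (simp add: mu_UNIV)
qed

lemma mu_crossing:
  assumes C: "line_arrangement C" and v: "v \<in> crossings C"
  shows "mu C {v} = int (multiplicity_at C v) - 1"
proof -
  have fin: "finite C" and lines: "\<And>H. H \<in> C \<Longrightarrow> affine_line H"
    using C by (auto simp: line_arrangement_def)
  obtain H where H: "H \<in> C" "v \<in> H" using crossing_two_lines[OF fin v] .
  have sub: "{v} \<subset> H" if "H \<in> C" "v \<in> H" for H
    using two_points_on_line[OF lines[OF that(1)]] that(2) by blast
  have neq: "{v} \<noteq> UNIV" using sub[OF H] by blast
  have "{Y \<in> intersection_poset C. {v} \<subset> Y} = insert UNIV {H \<in> C. v \<in> H}"
    using sub neq by (auto simp: intersection_poset_eq[OF C])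
  moreover have "UNIV \<notin> {H \<in> C. v \<in> H}" using line_neq_UNIV lines by blast
  moreover have "(\<Sum>Y\<in>{H \<in> C. v \<in> H}. mu C Y) = (\<Sum>Y\<in>{H \<in> C. v \<in> H}. - 1)"
    using mu_line[OF C] by (intro sum.cong) auto
  ultimately show ?thesis
    using neq fin by (subst mu.simps) (simp add: mu_UNIV multiplicity_at_def)
qed

lemma flat_dim_UNIV: "flat_dim (UNIV :: ('a::field ^ 2) set) = 2"
proof -
  have "{u - v | u v. u \<in> (UNIV :: ('a ^ 2) set) \<and> v \<in> UNIV} = UNIV"
  proof -
    have "x = x - 0" for x :: "'a ^ 2" by simp
    then show ?thesis by blast
  qed
  then show ?thesis by (simp only: flat_dim_def vec_dim_card) simp
qed

lemma flat_dim_line: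
  assumes "affine_line (H :: ('a::field ^ 2) set)"
  shows "flat_dim H = 1"
proof -
  let ?w = "vector [coeff_y H, - coeff_x H] :: 'a ^ 2"
  have diff: "param H s - param H t = (s - t) *s ?w" for s t
    unfolding vec_eq_iff forall_2 by (simp add: param_nth algebra_simps)
  have "{u - v | u v. u \<in> H \<and> v \<in> H} = range (\<lambda>k. k *s ?w)"
  proof (intro equalityI subsetI)
    fix x assume "x \<in> {u - v | u v. u \<in> H \<and> v \<in> H}"
    then obtain u v where uv: "x = u - v" "u \<in> H" "v \<in> H" by blast
    from param_surj[OF assms uv(2)] obtain s where "u = param H s" .
    moreover from param_surj[OF assms uv(3)] obtain t where "v = param H t" .
    ultimately have "x = (s - t) *s ?w" using uv(1) diff[of s t] by (simp only:)
    then show "x \<in> range (\<lambda>k. k *s ?w)" by blast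
  next
    fix x assume "x \<in> range (\<lambda>k. k *s ?w)"
    then obtain k where "x = k *s ?w" by blast
    then have "x = param H k - param H 0" using diff[of k 0] by simp
    then show "x \<in> {u - v | u v. u \<in> H \<and> v \<in> H}" using param_mem[OF assms] by blast
  qed
  then have "{u - v | u v. u \<in> H \<and> v \<in> H} = vec.span {?w}"
    by (simp add: vec.span_singleton)
  moreover have "?w \<noteq> 0"
    using line_coeffs(1)[OF assms] by (auto simp: vec_eq_iff forall_2)
  ultimately show ?thesis
    by (simp add: flat_dim_def vec.dim_span vec.dim_singleton)
qed

lemma flat_dim_point: "flat_dim {v} = 0"
proof -
  have "{a - b | a b. a \<in> {v} \<and> b \<in> {v}} = {0}" by auto
  then show ?thesis by (simp add: flat_dim_def)
qed

theorem char_poly_eq: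
  assumes C: "line_arrangement (C :: ('a::field ^ 2) set set)"
  shows "char_poly C = [:int (second_betti C), - int (card C), 1:]"
proof -
  have fin: "finite C" and lines: "\<And>H. H \<in> C \<Longrightarrow> affine_line H"
    using C by (auto simp: line_arrangement_def)
  have not_single: "H \<noteq> {v}" if "H \<in> C" for H v
    using two_points_on_line[OF lines[OF that]] by blast
  have "(UNIV :: ('a ^ 2) set) \<noteq> {v}" for v
  proof
    assume *: "(UNIV :: ('a ^ 2) set) = {v}"
    have "(vector [0, 0] :: 'a ^ 2) = vector [1, 0]" using * by (metis UNIV_I singletonD)
    then have "(vector [0, 0] :: 'a ^ 2) $ 1 = vector [1, 0] $ 1" by simp
    then show False by simp
  qed
  then have 1: "UNIV \<notin> C \<union> (\<lambda>v. {v}) ` crossings C" using lines line_neq_UNIV by blast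
  have 2: "C \<inter> (\<lambda>v. {v}) ` crossings C = {}" using not_single by blast
  have fP: "finite (crossings C)" by (rule finite_crossings[OF C])
  have "(\<Sum>X\<in>C. monom (mu C X) (flat_dim X)) = (\<Sum>X\<in>C. [:0, - 1:])"
    using lines by (intro sum.cong) (simp_all add: mu_line[OF C] flat_dim_line monom_Suc monom_0)
  also have "\<dots> = [:0, - int (card C):]" by (simp add: of_nat_poly)
  finally have sC: "(\<Sum>X\<in>C. monom (mu C X) (flat_dim X)) = [:0, - int (card C):]" .
  have "(\<Sum>X\<in>(\<lambda>v. {v}) ` crossings C. monom (mu C X) (flat_dim X))
      = (\<Sum>v\<in>crossings C. monom (mu C {v}) (flat_dim {v}))"
    by (subst sum.reindex) (auto simp: inj_on_def)
  also have "\<dots> = (\<Sum>v\<in>crossings C. [:int (multiplicity_at C v - 1):])"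
  proof (rule sum.cong[OF refl])
    fix v assume v: "v \<in> crossings C"
    then have "1 \<le> multiplicity_at C v" by (simp add: crossings_def)
    then show "monom (mu C {v}) (flat_dim {v}) = [:int (multiplicity_at C v - 1):]"
      by (simp add: mu_crossing[OF C v] flat_dim_point monom_0 of_nat_diff)
  qed
  also have "\<dots> = [:int (second_betti C):]"
    unfolding second_betti_def using fP by (induction rule: finite_induct) simp_all
  finally have sP: "(\<Sum>X\<in>(\<lambda>v. {v}) ` crossings C. monom (mu C X) (flat_dim X))
      = [:int (second_betti C):]" .
  have "char_poly C = monom (mu C UNIV) (flat_dim (UNIV :: ('a ^ 2) set)) +
      ([:0, - int (card C):] + [:int (second_betti C):])"
    unfolding char_poly_def intersection_poset_eq[OF C] using fin fP 1 2
    by (simp add: sum.union_disjoint sC sP)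
  then show ?thesis
    by (simp add: mu_UNIV[OF fin] flat_dim_UNIV monom_Suc monom_0 numeral_2_eq_2)
qed

section \<open>Derivations\<close>

text \<open>The part of \<open>derivation\<close> that makes sense over every ring, so that it can be lifted from a ring of
  coefficients to polynomials over it.\<close>

definition leibniz :: "('r::comm_ring_1 \<Rightarrow> 'r) \<Rightarrow> bool" where
  "leibniz D \<longleftrightarrow> (\<forall>f g. D (f + g) = D f + D g) \<and> (\<forall>f g. D (f * g) = f * D g + g * D f)"

lemma leibniz_0: "leibniz D \<Longrightarrow> D 0 = 0"
  unfolding leibniz_def by (metis add_cancel_right_right)

lemma leibniz_pderiv: "leibniz (pderiv :: 'r::idom poly \<Rightarrow> _)"
  by (simp add: leibniz_def pderiv_add pderiv_mult mult.commute)

lemma leibniz_sum: "leibniz D \<Longrightarrow> D (\<Sum>i\<in>A. f i) = (\<Sum>i\<in>A. D (f i))"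
  by (induction A rule: infinite_finite_induct) (simp_all add: leibniz_0, simp add: leibniz_def)

lemma leibniz_map_poly:
  assumes D: "leibniz D"
  shows "leibniz (map_poly D)"
proof -
  have D0: "D 0 = 0" using D by (rule leibniz_0)
  have Dm: "D (a * b) = a * D b + b * D a" and Da: "D (a + b) = D a + D b" for a b
    using D by (auto simp: leibniz_def)
  have "map_poly D (f * g) = f * map_poly D g + map_poly D f * g" for f g
  proof (rule poly_eqI)
    fix n
    have "coeff (map_poly D (f * g)) n = (\<Sum>i\<le>n. D (coeff f i * coeff g (n - i)))"
      by (simp add: coeff_map_poly D0 coeff_mult leibniz_sum[OF D])
    also have "\<dots> = (\<Sum>i\<le>n. coeff f i * D (coeff g (n - i)) + D (coeff f i) * coeff g (n - i))"
      by (simp add: Dm mult.commute)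
    also have "\<dots> = coeff (f * map_poly D g + map_poly D f * g) n"
      by (simp add: coeff_mult coeff_map_poly D0 sum.distrib)
    finally show "coeff (map_poly D (f * g)) n = coeff (f * map_poly D g + map_poly D f * g) n" .
  qed
  moreover have "map_poly D (f + g) = map_poly D f + map_poly D g" for f g
    by (rule poly_eqI) (simp add: coeff_map_poly D0 Da)
  ultimately show ?thesis by (simp add: leibniz_def mult.commute)
qed

lemmas vars = var_x_def var_y_def var_z_def

definition dx :: "'a::field poly3 \<Rightarrow> 'a poly3" where "dx = map_poly (map_poly pderiv)"
definition dy :: "'a::field poly3 \<Rightarrow> 'a poly3" where "dy = map_poly pderiv"

lemma leibniz_dx: "leibniz (dx :: 'a::field poly3 \<Rightarrow> _)"
  unfolding dx_def by (intro leibniz_map_poly leibniz_pderiv)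

lemma leibniz_dy: "leibniz (dy :: 'a::field poly3 \<Rightarrow> _)"
  unfolding dy_def by (intro leibniz_map_poly leibniz_pderiv)

lemma dx_vars: "dx var_x = 1" "dx var_y = 0" "dx var_z = 0" "dx (const3 c) = 0"
  by (simp_all add: dx_def vars const3_def map_poly_pCons pderiv_pCons one_pCons)

lemma dy_vars: "dy var_x = 0" "dy var_y = 1" "dy var_z = 0" "dy (const3 c) = 0"
  by (simp_all add: dy_def vars const3_def map_poly_pCons pderiv_pCons one_pCons)

lemma euler_vars:
  "euler_derivation var_x = var_x" "euler_derivation var_y = var_y" "euler_derivation var_z = var_z"
  by (simp_all add: euler_derivation_def vars map_poly_pCons pderiv_pCons one_pCons)

lemma derivationD:
  assumes "derivation \<theta>"
  shows "\<theta> (f + g) = \<theta> f + \<theta> g" "\<theta> (const3 c * f) = const3 c * \<theta> f"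
    "\<theta> (f * g) = f * \<theta> g + g * \<theta> f"
  using assms unfolding derivation_def by blast+

lemma derivation_dx_dy: "derivation (\<lambda>h. f * dx h + g * dy h)"
proof -
  have x: "dx (a + b) = dx a + dx b" "dx (a * b) = a * dx b + b * dx a"
    and y: "dy (a + b) = dy a + dy b" "dy (a * b) = a * dy b + b * dy a" for a b :: "'a poly3"
    using leibniz_dx leibniz_dy unfolding leibniz_def by blast+
  show ?thesis
    by (simp add: derivation_def x y dx_vars dy_vars algebra_simps)
qed

lemma derivation_combination:
  assumes "derivation \<theta>0" "derivation \<theta>1" "derivation \<theta>2"
  shows "derivation (\<lambda>g. a0 * \<theta>0 g + a1 * \<theta>1 g + a2 * \<theta>2 g)"
  unfolding derivation_def
  by (simp only: derivationD(1,2)[OF assms(1)] derivationD(1,2)[OF assms(2)]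
      derivationD(1,2)[OF assms(3)]) (simp add: derivationD(3)[OF assms(1)] derivationD(3)[OF assms(2)]
      derivationD(3)[OF assms(3)] algebra_simps)

lemma derivation_linear:
  assumes "derivation \<theta>"
  shows "\<theta> (const3 p * var_x + const3 q * var_y + const3 r * var_z) =
    const3 p * \<theta> var_x + const3 q * \<theta> var_y + const3 r * \<theta> var_z"
  by (simp only: derivationD(1,2)[OF assms])

lemma derivation_eq_0:
  assumes \<theta>: "derivation (\<theta> :: 'a::field poly3 \<Rightarrow> _)"
    and vars0: "\<theta> var_x = 0" "\<theta> var_y = 0" "\<theta> var_z = 0"
  shows "\<theta> f = 0"
proof -
  have add: "\<theta> (f + g) = \<theta> f + \<theta> g" and mult: "\<theta> (f * g) = f * \<theta> g + g * \<theta> f"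
    and scale: "\<theta> (const3 c * f) = const3 c * \<theta> f" for f g c
    by (rule derivationD[OF \<theta>])+
  have "\<theta> 1 = \<theta> 1 + \<theta> 1" using mult[of 1 1] by (simp only: mult_1_left)
  then have "\<theta> 1 = 0" by (metis add_cancel_left_right)
  then have const: "\<theta> (const3 c) = 0" for c using scale[of c 1] by simp
  then have zero: "\<theta> 0 = 0" by (metis const3_def pCons_0_0)
  have x: "\<theta> [:[:a:]:] = 0" for a
  proof (induction a)
    case (pCons c a)
    have "[:[:pCons c a:]:] = const3 c + var_x * [:[:a:]:]" by (simp add: const3_def vars)
    then show ?case by (simp only: add mult const vars0 pCons.IH) simp
  qed (simp add: zero)
  have y: "\<theta> [:a:] = 0" for a
  proof (induction a)
    case (pCons c a)
    have "[:pCons c a:] = [:[:c:]:] + var_y * [:a:]" by (simp add: vars)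
    then show ?case by (simp only: add mult x vars0 pCons.IH) simp
  qed (simp add: zero)
  show ?thesis
  proof (induction f)
    case (pCons c a)
    have "pCons c a = [:c:] + var_z * a" by (simp add: vars)
    then show ?case by (simp only: add mult y vars0 pCons.IH) simp
  qed (simp add: zero)
qed

lemma graded_const_const: "graded [:[:c:]:] = [:const2 c:]"
  using graded_const2[of c] by (simp add: const2_def)

lemma graded3_const3: "graded3 (const3 c) = [:const2 c:]"
  by (simp add: const3_def graded3_pCons graded3.hom_0 graded_const_const)

lemma graded3_var_z: "graded3 var_z = [:0, 1:]"
  by (simp add: var_z_def graded3_pCons graded3.hom_0 graded.hom_0 graded.hom_1)

lemma graded3_var_x: "graded3 var_x = [:0, [:[:0, 1:]:]:]"
  by (simp add: vars graded3_pCons graded3.hom_0 graded_pCons graded.hom_0 graded_x_pCons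
      graded_x.hom_0 const2_def)

lemma graded3_var_y: "graded3 var_y = [:0, [:0, 1:]:]"
  by (simp add: vars graded3_pCons graded3.hom_0 graded_pCons graded.hom_0 graded_x_pCons
      graded_x.hom_0 const2_def one_pCons)

lemma graded3_linear:
  "graded3 (const3 p * var_x + const3 q * var_y + const3 r * var_z) = [:0, lin p q r:]"
  by (simp add: graded3.hom_add graded3.hom_mult graded3_const3 graded3_var_x graded3_var_y
      graded3_var_z lin_def const2_def)

section \<open>From free modules of derivations to bases of pairs\<close>

abbreviation combine :: "'a::field poly2 \<Rightarrow> 'a poly2 \<Rightarrow> 'a poly2 \<times> 'a poly2 \<Rightarrow> 'a poly2 \<times> 'a poly2 \<Rightarrow> 'a poly2 \<times> 'a poly2" where
  "combine a b \<phi> \<psi> \<equiv> (a * fst \<phi> + b * fst \<psi>, a * snd \<phi> + b * snd \<psi>)"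

text \<open>The degree bounds on the coefficients are what remains of the homogeneity of a basis after \<open>z = 1\<close>.\<close>

definition log_basis :: "('a::field ^ 2) set set \<Rightarrow> nat \<Rightarrow> nat \<Rightarrow>
    'a poly2 \<times> 'a poly2 \<Rightarrow> 'a poly2 \<times> 'a poly2 \<Rightarrow> bool" where
  "log_basis C d1 d2 \<phi> \<psi> \<longleftrightarrow> \<phi> \<in> log_pairs (Suc d1) C \<and> \<psi> \<in> log_pairs (Suc d2) C \<and>
    (\<forall>a b. combine a b \<phi> \<psi> = (0, 0) \<longrightarrow> a = 0 \<and> b = 0) \<and>
    (\<forall>n. \<forall>\<xi>\<in>log_pairs n C.
      \<exists>a\<in>low_polys2 (n - d1). \<exists>b\<in>low_polys2 (n - d2). \<xi> = combine a b \<phi> \<psi>)"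

lemma log_basisD:
  assumes "log_basis C d1 d2 \<phi> \<psi>"
  shows "\<phi> \<in> log_pairs (Suc d1) C" "\<psi> \<in> log_pairs (Suc d2) C"
    "combine a b \<phi> \<psi> = (0, 0) \<Longrightarrow> a = 0 \<and> b = 0"
    "\<xi> \<in> log_pairs n C \<Longrightarrow>
      \<exists>a\<in>low_polys2 (n - d1). \<exists>b\<in>low_polys2 (n - d2). \<xi> = combine a b \<phi> \<psi>"
proof -
  note * = assms[unfolded log_basis_def]
  show "\<phi> \<in> log_pairs (Suc d1) C" "\<psi> \<in> log_pairs (Suc d2) C"
    using * by simp_all
  show "combine a b \<phi> \<psi> = (0, 0) \<Longrightarrow> a = 0 \<and> b = 0"
    by (rule *[THEN conjunct2, THEN conjunct2, THEN conjunct1, rule_format])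
  show "\<xi> \<in> log_pairs n C \<Longrightarrow>
      \<exists>a\<in>low_polys2 (n - d1). \<exists>b\<in>low_polys2 (n - d2). \<xi> = combine a b \<phi> \<psi>"
    by (rule *[THEN conjunct2, THEN conjunct2, THEN conjunct2, rule_format])
qed

lemma log_basisI:
  assumes "\<phi> \<in> log_pairs (Suc d1) C" "\<psi> \<in> log_pairs (Suc d2) C"
    "\<And>a b. combine a b \<phi> \<psi> = (0, 0) \<Longrightarrow> a = 0 \<and> b = 0"
    "\<And>n \<xi>. \<xi> \<in> log_pairs n C \<Longrightarrow>
      \<exists>a\<in>low_polys2 (n - d1). \<exists>b\<in>low_polys2 (n - d2). \<xi> = combine a b \<phi> \<psi>"
  shows "log_basis C d1 d2 \<phi> \<psi>"
  unfolding log_basis_def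
proof (intro conjI)
  show "\<forall>a b. combine a b \<phi> \<psi> = (0, 0) \<longrightarrow> a = 0 \<and> b = 0"
    by (intro allI impI assms(3))
  show "\<forall>n. \<forall>\<xi>\<in>log_pairs n C.
      \<exists>a\<in>low_polys2 (n - d1). \<exists>b\<in>low_polys2 (n - d2). \<xi> = combine a b \<phi> \<psi>"
    by (intro allI ballI assms(4))
qed (rule assms)+

lemma log_basis_swap:
  assumes "log_basis C d1 d2 \<phi> \<psi>"
  shows "log_basis C d2 d1 \<psi> \<phi>"
proof (rule log_basisI)
  have swap: "combine b a \<psi> \<phi> = combine a b \<phi> \<psi>" for a b by (simp add: add.commute)
  show "\<psi> \<in> log_pairs (Suc d2) C" "\<phi> \<in> log_pairs (Suc d1) C"
    by (rule log_basisD[OF assms])+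
  show "b = 0 \<and> a = 0" if "combine b a \<psi> \<phi> = (0, 0)" for a b
    using log_basisD(3)[OF assms, of a b] that unfolding swap by simp
  show "\<exists>b\<in>low_polys2 (n - d2). \<exists>a\<in>low_polys2 (n - d1). \<xi> = combine b a \<psi> \<phi>"
    if "\<xi> \<in> log_pairs n C" for n \<xi>
    using log_basisD(4)[OF assms that] unfolding swap by blast
qed

text \<open>As \<open>z\<close> divides \<open>\<theta> z\<close>, subtracting a multiple \<open>e\<close> of the Euler derivation kills the value at \<open>z\<close>. The
  remaining coefficients \<open>X\<close> and \<open>Y\<close> are again homogeneous of degree \<open>d\<close>.\<close>

lemma dehomogenized_component:
  assumes \<theta>: "\<theta> \<in> log_derivations C" "homogeneous_derivation d \<theta>"
  obtains e X Y F G where "\<theta> var_z = e * var_z"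
    "\<theta> var_x = X + e * var_x" "\<theta> var_y = Y + e * var_y"
    "graded3 X = monom F d" "graded3 Y = monom G d"
    "F \<in> low_polys2 (Suc d)" "G \<in> low_polys2 (Suc d)"
proof -
  have "var_z dvd \<theta> var_z" using \<theta>(1) by (auto simp: log_derivations_def cone_forms_def)
  then obtain e where e: "\<theta> var_z = e * var_z" by (metis dvdE mult.commute)
  define X where "X = \<theta> var_x - e * var_x"
  define Y where "Y = \<theta> var_y - e * var_y"
  have component: "\<exists>F. graded3 (\<theta> v - e * v) = monom F d \<and> F \<in> low_polys2 (Suc d)"
    if v: "homogeneous d (\<theta> v)" "graded3 v = monom V 1" for v V
  proof -
    obtain a b where a: "graded3 (\<theta> v) = monom a d" and b: "graded3 (\<theta> var_z) = monom b d"
      using \<theta>(2) v(1) graded3_homogeneous unfolding homogeneous_derivation_def by metis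
    \<comment> \<open>Multiplied by \<open>z\<close>, the expression involves homogeneous polynomials only.\<close>
    have "var_z * (\<theta> v - e * v) = var_z * \<theta> v - v * \<theta> var_z"
      unfolding e by (simp add: algebra_simps)
    then have "graded3 (var_z * (\<theta> v - e * v)) = graded3 (var_z * \<theta> v - v * \<theta> var_z)" by simp
    then have "[:0, 1:] * graded3 (\<theta> v - e * v) = [:0, 1:] * monom a d - monom V 1 * monom b d"
      by (simp only: graded3.hom_mult graded3.hom_diff a b v(2) graded3_var_z)
    also have "\<dots> = [:0, 1:] * monom (a - V * b) d"
      by (simp add: mult_monom monom_Suc diff_monom[symmetric] smult_monom)
    finally have eq: "graded3 (\<theta> v - e * v) = monom (a - V * b) d" by simp
    then have "a - V * b = coeff (graded3 (\<theta> v - e * v)) d" by simp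
    then have "a - V * b \<in> low_polys2 (Suc d)"
      using coeff_graded3_low by metis
    with eq show ?thesis by blast
  qed
  have "\<exists>F. graded3 X = monom F d \<and> F \<in> low_polys2 (Suc d)"
    unfolding X_def using \<theta>(2)
    by (intro component[of var_x "[:[:0, 1:]:]"])
      (auto simp: homogeneous_derivation_def graded3_var_x monom_Suc monom_0)
  moreover have "\<exists>G. graded3 Y = monom G d \<and> G \<in> low_polys2 (Suc d)"
    unfolding Y_def using \<theta>(2)
    by (intro component[of var_y "[:0, 1:]"])
      (auto simp: homogeneous_derivation_def graded3_var_y monom_Suc monom_0)
  ultimately obtain F G where "graded3 X = monom F d" "graded3 Y = monom G d"
    "F \<in> low_polys2 (Suc d)" "G \<in> low_polys2 (Suc d)" by blast
  moreover have "\<theta> var_x = X + e * var_x" "\<theta> var_y = Y + e * var_y"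
    by (simp_all add: X_def Y_def)
  ultimately show ?thesis using that e by blast
qed

lemma component_log_pair:
  assumes C: "line_arrangement C" and \<theta>: "\<theta> \<in> log_derivations C"
    and z: "\<theta> var_z = e * var_z"
    and x: "\<theta> var_x = X + e * var_x" and y: "\<theta> var_y = Y + e * var_y"
    and F: "graded3 X = monom F d" and G: "graded3 Y = monom G d"
    and low: "F \<in> low_polys2 (Suc d)" "G \<in> low_polys2 (Suc d)"
  shows "(F, G) \<in> log_pairs (Suc d) C"
proof -
  have "form H dvd deriv_form H (F, G)" if H: "H \<in> C" for H
  proof -
    have aff: "affine_line H" using C H by (simp add: line_arrangement_def)
    let ?\<alpha> = "const3 (coeff_x H) * var_x + const3 (coeff_y H) * var_y + const3 (coeff_1 H) * var_z"
    have "line_of (coeff_x H) (coeff_y H) (coeff_1 H) \<in> C" using line_coeffs(2)[OF aff] H by metis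
    then have "?\<alpha> \<in> cone_forms C"
      using line_coeffs(1)[OF aff] by (auto simp: cone_forms_def)
    then have dvd: "?\<alpha> dvd \<theta> ?\<alpha>" using \<theta> by (auto simp: log_derivations_def)
    have "\<theta> ?\<alpha> = const3 (coeff_x H) * X + const3 (coeff_y H) * Y + e * ?\<alpha>"
      using \<theta> by (subst derivation_linear) (simp_all add: log_derivations_def x y z algebra_simps)
    then have "?\<alpha> dvd const3 (coeff_x H) * X + const3 (coeff_y H) * Y"
      using dvd by (metis dvd_add_left_iff dvd_triv_right)
    then have "graded3 ?\<alpha> dvd graded3 (const3 (coeff_x H) * X + const3 (coeff_y H) * Y)"
      by (rule graded3.hom_dvd)
    moreover have "graded3 (const3 (coeff_x H) * X + const3 (coeff_y H) * Y) = monom (deriv_form H (F, G)) d"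
      by (simp add: deriv_form_def graded3.hom_add graded3.hom_mult graded3_const3 F G
          smult_monom add_monom)
    ultimately have "[:0, form H:] dvd monom (deriv_form H (F, G)) d"
      by (simp only: graded3_linear form_def)
    then obtain K where "monom (deriv_form H (F, G)) d = [:0, form H:] * K" by (elim dvdE)
    then have "coeff (monom (deriv_form H (F, G)) d) d = coeff ([:0, form H:] * K) d" by simp
    also have "[:0, form H:] * K = smult (form H) (pCons 0 K)" by simp
    finally have "deriv_form H (F, G) = form H * coeff (pCons 0 K) d"
      by (simp only: coeff_monom coeff_smult if_True simp_thms)
    then show ?thesis by (rule dvdI)
  qed
  then show ?thesis using low by (simp add: log_pairs_def)
qed

text \<open>Homogenize the pair and the quotients by the linear forms. The quotients have degree one less, hence
  the case distinction on \<open>d = 0\<close>.\<close>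

lemma homogenized_log_derivation:
  assumes C: "line_arrangement C" and \<phi>: "\<phi> \<in> log_pairs (Suc d) C"
  obtains f g where "graded3 f = monom (fst \<phi>) d" "graded3 g = monom (snd \<phi>) d"
    "(\<lambda>h. f * dx h + g * dy h) \<in> log_derivations C"
proof -
  obtain f where f: "graded3 f = monom (fst \<phi>) d"
    using \<phi> homogenization by (auto simp: log_pairs_def)
  obtain g where g: "graded3 g = monom (snd \<phi>) d"
    using \<phi> homogenization by (auto simp: log_pairs_def)
  let ?\<theta> = "\<lambda>h. f * dx h + g * dy h"
  have der: "derivation ?\<theta>" by (rule derivation_dx_dy)
  have "\<alpha> dvd ?\<theta> \<alpha>" if \<alpha>: "\<alpha> \<in> cone_forms C" for \<alpha>
  proof (cases "\<alpha> = var_z")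
    case True
    then show ?thesis by (simp add: dx_vars dy_vars)
  next
    case False
    with \<alpha> obtain p q r where pqr: "\<alpha> = const3 p * var_x + const3 q * var_y + const3 r * var_z"
      "line_of p q r \<in> C" by (auto simp: cone_forms_def)
    define H where "H = line_of p q r"
    have H: "H \<in> C" "affine_line H" using C pqr(2) by (auto simp: H_def line_arrangement_def)
    from lin_of_line[OF H_def[symmetric] H(2)] obtain c
      where c: "p = c * coeff_x H" "q = c * coeff_y H" "lin p q r = const2 c * form H" by metis
    have \<theta>\<alpha>: "?\<theta> \<alpha> = const3 p * f + const3 q * g"
      unfolding pqr(1) by (subst derivation_linear[OF der]) (simp add: dx_vars dy_vars)
    have gr: "graded3 (?\<theta> \<alpha>) = monom (const2 c * deriv_form H \<phi>) d"
      unfolding \<theta>\<alpha> c(1,2)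
      by (simp add: graded3.hom_add graded3.hom_mult graded3_const3 f g smult_monom add_monom
          deriv_form_def const2.hom_mult algebra_simps)
    have "form H dvd deriv_form H \<phi>" using \<phi> H(1) by (simp add: log_pairs_def)
    then obtain K where K: "deriv_form H \<phi> = form H * K" by (elim dvdE)
    have "K \<in> low_polys2 (Suc d - tdeg (form H))"
      using deriv_form_low_polys2[OF \<phi>, of H] unfolding K
      by (rule low_polys2_mult_cancel) (rule form_nonzero[OF H(2)])
    then have K_low: "K \<in> low_polys2 d" by (simp add: tdeg_form[OF H(2)])
    show ?thesis
    proof (cases d)
      case 0
      then have "K = 0" using K_low by (simp add: low_polys2_iff)
      then have "graded3 (?\<theta> \<alpha>) = 0" using gr K by simp
      then have "?\<theta> \<alpha> = 0" by (simp only: graded3_eq_0_iff)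
      then show ?thesis by (simp only: dvd_0_right)
    next
      case (Suc e)
      from homogenization[OF K_low[unfolded Suc]] obtain k where k: "graded3 k = monom K e" .
      have "graded3 (\<alpha> * k) = [:0, const2 c * form H:] * monom K e"
        by (simp only: graded3.hom_mult k pqr(1) graded3_linear c(3))
      also have "\<dots> = monom (const2 c * deriv_form H \<phi>) d"
        by (simp add: K Suc monom_Suc smult_monom mult.assoc)
      finally have "graded3 (\<alpha> * k) = graded3 (?\<theta> \<alpha>)" by (simp only: gr)
      then have "?\<theta> \<alpha> = \<alpha> * k" by (simp only: graded3_inject)
      then show ?thesis by (rule dvdI)
    qed
  qed
  then have "?\<theta> \<in> log_derivations C" using der by (simp add: log_derivations_def)
  then show ?thesis using that f g by blast
qed

lemma coeff_mult_monom_le: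
  "coeff (p * monom F e) d = (if e \<le> d then coeff p (d - e) * F else (0 :: 'b::comm_ring_1))"
  by (subst mult.commute) (simp add: coeff_monom_mult mult.commute[of F])

text \<open>Coefficients with respect to the homogeneous basis may be inhomogeneous; comparing the components of
  degree \<open>d\<close>, that is, the coefficients of \<open>t\<^sup>d\<close> after \<open>graded3\<close>, gives the degree bounds.\<close>

theorem free_log_basis:
  assumes C: "line_arrangement (C :: ('a::field ^ 2) set set)" and free: "free_with_exponents C d1 d2"
  obtains \<phi> \<psi> where "log_basis C d1 d2 \<phi> \<psi>"
proof -
  obtain \<theta>1 \<theta>2 where sub: "{euler_derivation, \<theta>1, \<theta>2} \<subseteq> log_derivations C"
    and hom: "homogeneous_derivation d1 \<theta>1" "homogeneous_derivation d2 \<theta>2"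
    and span: "\<forall>\<theta>\<in>log_derivations C. \<exists>f0 f1 f2.
        \<theta> = (\<lambda>g. f0 * euler_derivation g + f1 * \<theta>1 g + f2 * \<theta>2 g)"
    and indep: "\<forall>f0 f1 f2. (\<lambda>g. f0 * euler_derivation g + f1 * \<theta>1 g + f2 * \<theta>2 g) = (\<lambda>g. 0)
        \<longrightarrow> f0 = 0 \<and> f1 = 0 \<and> f2 = 0"
    using free unfolding free_with_exponents_def by (elim exE conjE) (rule that)
  from sub have log: "euler_derivation \<in> log_derivations C" "\<theta>1 \<in> log_derivations C"
      "\<theta>2 \<in> log_derivations C" by simp_all
  from dehomogenized_component[OF log(2) hom(1)] obtain e1 X1 Y1 F1 G1 where
    1: "\<theta>1 var_z = e1 * var_z" "\<theta>1 var_x = X1 + e1 * var_x" "\<theta>1 var_y = Y1 + e1 * var_y"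
    "graded3 X1 = monom F1 d1" "graded3 Y1 = monom G1 d1"
    "F1 \<in> low_polys2 (Suc d1)" "G1 \<in> low_polys2 (Suc d1)" .
  from dehomogenized_component[OF log(3) hom(2)] obtain e2 X2 Y2 F2 G2 where
    2: "\<theta>2 var_z = e2 * var_z" "\<theta>2 var_x = X2 + e2 * var_x" "\<theta>2 var_y = Y2 + e2 * var_y"
    "graded3 X2 = monom F2 d2" "graded3 Y2 = monom G2 d2"
    "F2 \<in> low_polys2 (Suc d2)" "G2 \<in> low_polys2 (Suc d2)" .
  have pairs: "(F1, G1) \<in> log_pairs (Suc d1) C" "(F2, G2) \<in> log_pairs (Suc d2) C"
    using component_log_pair[OF C log(2) 1] component_log_pair[OF C log(3) 2] .
  have z0: "(var_z :: 'a poly3) \<noteq> 0" by (simp add: vars)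
  have indep_pairs: "a = 0 \<and> b = 0" if eq: "a * F1 + b * F2 = 0" "a * G1 + b * G2 = 0" for a b
  proof -
    \<comment> \<open>Any common degree that is large enough to homogenize both products.\<close>
    define M where "M = d1 + d2 + tdeg a + tdeg b"
    have "a \<in> low_polys2 (Suc (M - d1))" "b \<in> low_polys2 (Suc (M - d2))"
      by (simp_all add: low_polys2_iff M_def)
    then obtain a' b' where ab: "graded3 a' = monom a (M - d1)" "graded3 b' = monom b (M - d2)"
      using homogenization by metis
    have M: "M - d1 + d1 = M" "M - d2 + d2 = M" by (simp_all add: M_def)
    have "graded3 (a' * X1 + b' * X2) = 0" "graded3 (a' * Y1 + b' * Y2) = 0"
      by (simp_all add: graded3.hom_add graded3.hom_mult ab 1(4,5) 2(4,5) mult_monom M add_monom eq)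
    then have 0: "a' * X1 + b' * X2 = 0" "a' * Y1 + b' * Y2 = 0"
      by (simp_all only: graded3_eq_0_iff)
    define \<theta> where "\<theta> = (\<lambda>g. - (a' * e1 + b' * e2) * euler_derivation g + a' * \<theta>1 g + b' * \<theta>2 g)"
    have der: "derivation \<theta>"
      unfolding \<theta>_def using log by (intro derivation_combination) (auto simp: log_derivations_def)
    have vals: "\<theta> var_x = a' * X1 + b' * X2" "\<theta> var_y = a' * Y1 + b' * Y2" "\<theta> var_z = 0"
      by (simp_all add: \<theta>_def euler_vars 1(1-3) 2(1-3) algebra_simps)
    have "\<theta> g = 0" for g by (rule derivation_eq_0[OF der]) (simp_all only: vals 0)
    then have "\<theta> = (\<lambda>g. 0)" by (rule ext)
    from indep[rule_format, OF this[unfolded \<theta>_def]] have "a' = 0" "b' = 0" by simp_all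
    then have "monom a (M - d1) = 0" "monom b (M - d2) = 0"
      using ab by (simp_all add: graded3.hom_0)
    then show ?thesis by simp
  qed
  have span_pairs: "\<exists>a\<in>low_polys2 (n - d1). \<exists>b\<in>low_polys2 (n - d2). \<xi> = combine a b (F1, G1) (F2, G2)"
    if \<xi>: "\<xi> \<in> log_pairs n C" for n \<xi>
  proof (cases n)
    case 0
    then have "\<xi> = (0, 0)" using \<xi> by (cases \<xi>) (simp add: log_pairs_def low_polys2_iff)
    then show ?thesis by (intro bexI[of _ 0]) (simp_all add: low_polys2_iff)
  next
    case (Suc d)
    from homogenized_log_derivation[OF C \<xi>[unfolded Suc]] obtain f g
      where fg: "graded3 f = monom (fst \<xi>) d" "graded3 g = monom (snd \<xi>) d"
        and \<theta>: "(\<lambda>h. f * dx h + g * dy h) \<in> log_derivations C" .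
    from bspec[OF span \<theta>] obtain f0 f1 f2 where
      "(\<lambda>h. f * dx h + g * dy h) = (\<lambda>g. f0 * euler_derivation g + f1 * \<theta>1 g + f2 * \<theta>2 g)" by blast
    then have eq: "f * dx h + g * dy h = f0 * euler_derivation h + f1 * \<theta>1 h + f2 * \<theta>2 h" for h
      by (rule fun_cong)
    have "(f0 + f1 * e1 + f2 * e2) * var_z = 0"
      using eq[of var_z] by (simp add: dx_vars dy_vars euler_vars 1(1) 2(1) algebra_simps)
    then have "f0 + f1 * e1 + f2 * e2 = 0" using z0 by simp
    then have f0: "f0 = - (f1 * e1 + f2 * e2)" by (metis add.assoc eq_neg_iff_add_eq_0)
    have f: "f = f1 * X1 + f2 * X2"
      using eq[of var_x] by (simp add: dx_vars dy_vars euler_vars 1(2) 2(2) f0 algebra_simps)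
    have g: "g = f1 * Y1 + f2 * Y2"
      using eq[of var_y] by (simp add: dx_vars dy_vars euler_vars 1(3) 2(3) f0 algebra_simps)
    define a where "a = (if d1 \<le> d then coeff (graded3 f1) (d - d1) else 0)"
    define b where "b = (if d2 \<le> d then coeff (graded3 f2) (d - d2) else 0)"
    have "a \<in> low_polys2 (n - d1)" "b \<in> low_polys2 (n - d2)"
      using coeff_graded3_low by (auto simp: a_def b_def Suc Suc_diff_le low_polys2_iff[of 0])
    moreover have "fst \<xi> = a * F1 + b * F2"
      using arg_cong[OF f, of "\<lambda>h. coeff (graded3 h) d"]
      by (simp add: fg graded3.hom_add graded3.hom_mult 1(4) 2(4) coeff_mult_monom_le a_def b_def)
    moreover have "snd \<xi> = a * G1 + b * G2"
      using arg_cong[OF g, of "\<lambda>h. coeff (graded3 h) d"]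
      by (simp add: fg graded3.hom_add graded3.hom_mult 1(5) 2(5) coeff_mult_monom_le a_def b_def)
    ultimately show ?thesis by (intro bexI[of _ a] bexI[of _ b]) (simp_all add: prod_eq_iff)
  qed
  have "log_basis C d1 d2 (F1, G1) (F2, G2)"
  proof (rule log_basisI[OF pairs])
    fix a b assume "combine a b (F1, G1) (F2, G2) = (0, 0)"
    then show "a = 0 \<and> b = 0" by (intro indep_pairs) simp_all
  next
    fix n \<xi> assume "\<xi> \<in> log_pairs n C"
    from span_pairs[OF this] show "\<exists>a\<in>low_polys2 (n - d1). \<exists>b\<in>low_polys2 (n - d2).
      \<xi> = combine a b (F1, G1) (F2, G2)" .
  qed
  then show ?thesis by (rule that)
qed

lemma has_dim_log_basis:
  assumes basis: "log_basis (C :: ('a::field ^ 2) set set) d1 d2 \<phi> \<psi>" and n: "d1 \<le> n" "d2 \<le> n"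
  shows "pairs.has_dim (log_pairs n C)
    ((n - d1) * (n - d1 + 1) div 2 + (n - d2) * (n - d2 + 1) div 2)"
proof -
  note log = log_basisD(1,2)[OF basis] and indep = log_basisD(3)[OF basis]
    and span = log_basisD(4)[OF basis, of _ n]
  let ?U = "low_polys2 (n - d1) \<times> low_polys2 (n - d2)"
  let ?T = "\<lambda>c. combine (fst c) (snd c) \<phi> \<psi>"
  have "Vector_Spaces.linear scale_pair scale_pair ?T"
    by unfold_locales (simp_all add: scale_pair_def algebra_simps)
  moreover note has_dim_Times[OF has_dim_low_polys2 has_dim_low_polys2, of "n - d1" "n - d2", where 'a='a]
  ultimately have "pairs.has_dim (?T ` ?U)
      ((n - d1) * (n - d1 + 1) div 2 + (n - d2) * (n - d2 + 1) div 2)"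
  proof (rule pairs_pairs.has_dim_injective_image)
    fix c assume "?T c = 0"
    then have "combine (fst c) (snd c) \<phi> \<psi> = (0, 0)" by (simp add: zero_prod_def)
    from indep[OF this] show "c = 0" by (simp add: prod_eq_iff)
  qed
  moreover have "?T ` ?U = log_pairs n C"
  proof (intro equalityI subsetI)
    fix \<xi> assume "\<xi> \<in> ?T ` ?U"
    then obtain a b where a: "a \<in> low_polys2 (n - d1)" and b: "b \<in> low_polys2 (n - d2)"
      and \<xi>: "\<xi> = combine a b \<phi> \<psi>" by auto
    have low: "c * F \<in> low_polys2 n" if "F \<in> low_polys2 (Suc d)" "c \<in> low_polys2 (n - d)" "d \<le> n"
      for c F :: "'a poly2" and d
    proof -
      have "tdeg F \<le> d" using that(1) by (auto simp: low_polys2_iff tdeg_def graded.hom_0)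
      from low_polys2_mult[OF this that(2)] show ?thesis using that(3) by (simp add: mult.commute)
    qed
    have "deriv_form H \<xi> = a * deriv_form H \<phi> + b * deriv_form H \<psi>" for H
      by (simp add: \<xi> deriv_form_def algebra_simps)
    then show "\<xi> \<in> log_pairs n C"
      using log n a b by (auto simp: log_pairs_def \<xi> intro!: low_polys2_add low)
  next
    fix \<xi> assume "\<xi> \<in> log_pairs n C"
    from span[OF this] show "\<xi> \<in> ?T ` ?U" by force
  qed
  ultimately show ?thesis by simp
qed

text \<open>Both dimension formulas are quadratic in \<open>n\<close> for all large \<open>n\<close>, so their coefficients agree. Two
  consecutive values of \<open>n\<close> suffice.\<close>

theorem exponents_sum_product:
  assumes C: "line_arrangement (C :: ('a::field ^ 2) set set)" and basis: "log_basis C d1 d2 \<phi> \<psi>"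
  shows "card C = d1 + d2" "second_betti C = d1 * d2"
proof -
  have eq: "(int n - d1) * (int n - d1 + 1) + (int n - d2) * (int n - d2 + 1) =
      2 * int n * (int n + 1) - 2 * int (card C) * int n
      + int (card C) * (int (card C) - 1) - 2 * int (second_betti C)"
    if n: "card C \<le> n" "d1 \<le> n" "d2 \<le> n" for n
  proof -
    let ?h = "\<lambda>k. k * (k + 1) div 2 :: nat"
    obtain m where m: "pairs.has_dim (log_pairs n C) m"
      "2 * int m = 2 * int n * (int n + 1) - 2 * int (card C) * int n
      + int (card C) * (int (card C) - 1) - 2 * int (second_betti C)"
      using has_dim_log_pairs[OF C n(1)] .
    have "m = ?h (n - d1) + ?h (n - d2)"
      using pairs.has_dim_unique[OF m(1) has_dim_log_basis[OF basis n(2,3)]] .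
    moreover have h: "2 * int (?h k) = int k * (int k + 1)" for k
    proof -
      have "2 * ?h k = k * (k + 1)" by simp
      then have "int (2 * ?h k) = int (k * (k + 1))" by (simp only:)
      then show ?thesis by (simp only: of_nat_mult of_nat_add of_nat_1 of_nat_numeral)
    qed
    ultimately have "2 * int m = int (n - d1) * (int (n - d1) + 1) + int (n - d2) * (int (n - d2) + 1)"
      by (simp only: of_nat_add distrib_left h)
    then show ?thesis using m(2) n by (simp only: of_nat_diff)
  qed
  define n where "n = card C + d1 + d2"
  define c where "c = int (card C)"
  define s where "s = int (second_betti C)"
  define x where "x = int n"
  have e0: "(x - d1) * (x - d1 + 1) + (x - d2) * (x - d2 + 1) =
      2 * x * (x + 1) - 2 * c * x + c * (c - 1) - 2 * s"
    using eq[of n] by (simp add: n_def c_def s_def x_def)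
  have e1: "((x + 1) - d1) * ((x + 1) - d1 + 1) + ((x + 1) - d2) * ((x + 1) - d2 + 1) =
      2 * (x + 1) * ((x + 1) + 1) - 2 * c * (x + 1) + c * (c - 1) - 2 * s"
    using eq[of "Suc n"] by (simp add: n_def c_def s_def x_def algebra_simps)
  have "2 * c = 2 * (int d1 + int d2)" using e0 e1 by (simp add: algebra_simps)
  then have c: "c = int d1 + int d2" by simp
  then show "card C = d1 + d2" by (simp add: c_def)
  have "2 * s = 2 * (int d1 * int d2)" using e0 by (simp add: c algebra_simps)
  then have "s = int (d1 * d2)" by simp
  then show "second_betti C = d1 * d2" by (simp only: s_def of_nat_eq_iff)
qed

section \<open>The determinant of a basis\<close>

definition pair_det :: "'a::field poly2 \<times> 'a poly2 \<Rightarrow> 'a poly2 \<times> 'a poly2 \<Rightarrow> 'a poly2" where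
  "pair_det \<phi> \<psi> = fst \<phi> * snd \<psi> - fst \<psi> * snd \<phi>"

text \<open>Cramer's rule: up to sign, the right-hand sides are the determinant times the two coefficients of the form
  of \<open>H\<close>, and one of these is nonzero. The divisor is written as a product in order to cover both the
  form and its square.\<close>

lemma dvd_pair_det:
  assumes "affine_line H"
    and "F * G dvd deriv_form H \<phi> * fst \<psi> - deriv_form H \<psi> * fst \<phi>"
    and "F * G dvd deriv_form H \<phi> * snd \<psi> - deriv_form H \<psi> * snd \<phi>"
  shows "F * G dvd pair_det \<phi> \<psi>"
proof -
  have "deriv_form H \<phi> * snd \<psi> - deriv_form H \<psi> * snd \<phi> = const2 (coeff_x H) * pair_det \<phi> \<psi>"
    "deriv_form H \<phi> * fst \<psi> - deriv_form H \<psi> * fst \<phi> = const2 (- coeff_y H) * pair_det \<phi> \<psi>"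
    by (simp_all add: deriv_form_def pair_det_def const2.hom_uminus algebra_simps)
  then show ?thesis
    using assms line_coeffs(1)[OF assms(1)] dvd_const2_mult_iff[of "coeff_x H"] dvd_const2_mult_iff[of "- coeff_y H"]
    by (metis neg_equal_0_iff_equal)
qed

lemma pair_det_nonzero:
  assumes "log_basis C d1 d2 \<phi> \<psi>"
  shows "pair_det \<phi> \<psi> \<noteq> 0"
proof
  assume 0: "pair_det \<phi> \<psi> = 0"
  note indep = log_basisD(3)[OF assms]
  have "combine (snd \<psi>) (- snd \<phi>) \<phi> \<psi> = (0, 0)" "combine (fst \<psi>) (- fst \<phi>) \<phi> \<psi> = (0, 0)"
    using 0 by (simp_all add: pair_det_def algebra_simps)
  from this[THEN indep] have "snd \<phi> = 0" "fst \<phi> = 0" by simp_all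
  then have "combine 1 0 \<phi> \<psi> = (0, 0)" by simp
  from indep[OF this] show False by simp
qed

lemma pair_det_dvd_bound:
  assumes C: "line_arrangement C" and basis: "log_basis C d1 d2 \<phi> \<psi>"
    and D: "D dvd pair_det \<phi> \<psi>"
  shows "tdeg D \<le> card C"
proof -
  obtain E where E: "pair_det \<phi> \<psi> = D * E" using D by (elim dvdE)
  have low: "F * G \<in> low_polys2 (Suc (d + e))"
    if "F \<in> low_polys2 (Suc d)" "G \<in> low_polys2 (Suc e)" for F G :: "'a poly2" and d e
  proof -
    have "tdeg F \<le> d" using that(1) by (auto simp: low_polys2_iff tdeg_def graded.hom_0)
    from low_polys2_mult[OF this that(2)] show ?thesis by simp
  qed
  have "fst \<phi> * snd \<psi> \<in> low_polys2 (Suc (d1 + d2))" "fst \<psi> * snd \<phi> \<in> low_polys2 (Suc (d2 + d1))"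
    using log_basisD(1,2)[OF basis] by (auto simp: log_pairs_def intro!: low)
  then have "fst \<phi> * snd \<psi> + - (fst \<psi> * snd \<phi>) \<in> low_polys2 (Suc (d1 + d2))"
    by (intro low_polys2_add low_polys2_minus) (simp_all add: add.commute)
  then have "pair_det \<phi> \<psi> \<in> low_polys2 (Suc (d1 + d2))"
    by (simp add: pair_det_def)
  then have "tdeg (pair_det \<phi> \<psi>) \<le> d1 + d2"
    using pair_det_nonzero[OF basis] by (simp add: low_polys2_iff)
  moreover have "tdeg (pair_det \<phi> \<psi>) = tdeg D + tdeg E"
    using pair_det_nonzero[OF basis] unfolding E by (intro tdeg_mult) auto
  ultimately show ?thesis using exponents_sum_product(1)[OF C basis] by simp
qed

lemma form_dvd_pair_det:
  assumes C: "line_arrangement C" and basis: "log_basis C d1 d2 \<phi> \<psi>" and H: "H \<in> C"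
  shows "form H dvd pair_det \<phi> \<psi>"
proof -
  have "form H dvd deriv_form H \<phi>" "form H dvd deriv_form H \<psi>"
    using log_basisD(1,2)[OF basis] H by (simp_all add: log_pairs_def)
  moreover have "affine_line H" using C H by (simp add: line_arrangement_def)
  ultimately show ?thesis using dvd_pair_det[of H "form H" 1 \<phi> \<psi>] by simp
qed

text \<open>Together with the forms of the other lines of \<open>C\<close> this power would have degree \<open>card C + 1\<close>.\<close>

lemma pair_det_multiplicity:
  assumes C: "line_arrangement C" and basis: "log_basis C d1 d2 \<phi> \<psi>" and L: "affine_line L"
  shows "\<not> form L ^ (if L \<in> C then 2 else 1) dvd pair_det \<phi> \<psi>"
proof
  let ?k = "if L \<in> C then 2 else 1 :: nat" and ?B = "C - {L}"
  assume L_dvd: "form L ^ ?k dvd pair_det \<phi> \<psi>"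
  interpret arrangement_with_line ?B L by (rule arrangement_with_line_Diff[OF C L])
  have "(\<Prod>H\<in>?B. form H) dvd pair_det \<phi> \<psi>"
    using form_dvd_pair_det[OF C basis] lines_A finite_A by (intro prod_forms_dvd) auto
  moreover have "restr L (\<Prod>H\<in>?B. form H) \<noteq> 0"
    using rform_nonzero finite_A by (auto simp: restr.hom_prod)
  ultimately have "form L ^ ?k * (\<Prod>H\<in>?B. form H) dvd pair_det \<phi> \<psi>"
    by (intro form_power_mult_dvd[OF L L_dvd])
  from pair_det_dvd_bound[OF C basis this]
  have "tdeg (form L ^ ?k * (\<Prod>H\<in>?B. form H)) \<le> card C" .
  moreover have "tdeg (form L ^ ?k) = ?k"
    using form_nonzero[OF L] tdeg_form[OF L] by (simp add: power2_eq_square tdeg_mult)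
  then have "tdeg (form L ^ ?k * (\<Prod>H\<in>?B. form H)) = ?k + card ?B"
    using form_nonzero[OF L] form_nonzero[OF lines_A] finite_A
      tdeg_prod_forms[OF finite_A lines_A]
    by (subst tdeg_mult) (auto simp del: Diff_iff)
  ultimately have "?k + card ?B \<le> card C" by simp
  moreover have "finite C" using C by (simp add: line_arrangement_def)
  ultimately show False by (auto split: if_splits simp: card_Diff_singleton card_gt_0_iff)
qed

section \<open>The intersection numbers\<close>

theorem points_on_line_of_arrangement:
  assumes C: "line_arrangement C" and basis: "log_basis C d1 d2 \<phi> \<psi>" and H: "H \<in> C"
  shows "card (points_on C H) \<le> d1 \<or> card (points_on C H) = d2"
proof (rule ccontr)
  have lineH: "affine_line H" using C H by (simp add: line_arrangement_def)
  let ?A = "C - {H}"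
  let ?k = "card (nodes ?A H)"
  interpret arrangement_with_line ?A H by (rule arrangement_with_line_Diff[OF C lineH])
  assume "\<not> (card (points_on C H) \<le> d1 \<or> card (points_on C H) = d2)"
  then have k: "d1 < ?k" "?k \<noteq> d2" by (simp_all add: card_points_on[OF C lineH])
  have no: "\<not> form H ^ 2 dvd pair_det \<phi> \<psi>"
    using pair_det_multiplicity[OF C basis lineH] H by simp
  have log: "\<phi> \<in> log_pairs (Suc d1) ?A" "\<psi> \<in> log_pairs (Suc d2) ?A"
    and onH: "form H dvd deriv_form H \<phi>" "form H dvd deriv_form H \<psi>"
    using log_basisD(1,2)[OF basis] H by (auto simp: log_pairs_def)
  have "form H dvd fst \<phi>" "form H dvd snd \<phi>"
    using form_dvd_components[OF log(1) _ onH(1)] k(1) by simp_all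
  then obtain f g where fg: "fst \<phi> = form H * f" "snd \<phi> = form H * g" by (elim dvdE)
  show False
  proof (cases "d2 < ?k")
    case True
    then have "form H dvd fst \<psi>" "form H dvd snd \<psi>"
      using form_dvd_components[OF log(2) _ onH(2)] by simp_all
    then obtain f' g' where "fst \<psi> = form H * f'" "snd \<psi> = form H * g'" by (elim dvdE)
    with fg have "pair_det \<phi> \<psi> = form H ^ 2 * (f * g' - f' * g)"
      by (simp add: pair_det_def power2_eq_square algebra_simps)
    then show False using no by simp
  next
    case False
    then have k2: "?k < d2" using k(2) by simp
    have f0: "form H \<noteq> 0" by (rule form_nonzero[OF lineH])
    have low: "f \<in> low_polys2 d1" "g \<in> low_polys2 d1"
      using log(1) low_polys2_mult_cancel[OF _ f0, of _ "Suc d1"]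
      by (auto simp: log_pairs_def fg tdeg_form[OF lineH])
    have der: "deriv_form J \<phi> = form H * deriv_form J (f, g)" for J
      by (simp add: deriv_form_def fg algebra_simps)
    \<comment> \<open>The forms of \<open>J\<close> and \<open>H\<close> are coprime, so dividing by the latter leaves a logarithmic pair.\<close>
    have "form J dvd deriv_form J (f, g)" if J: "J \<in> ?A" for J
    proof -
      have "form J dvd form H * deriv_form J (f, g)"
        using log(1) J by (simp add: log_pairs_def der[symmetric])
      then have "restr J (form H) * restr J (deriv_form J (f, g)) = 0"
        by (simp add: restr_eq_0_iff[OF lines_A[OF J], symmetric] restr.hom_mult)
      moreover have "restr J (form H) \<noteq> 0"
        using restr_form_eq_0_iff[OF lines_A[OF J] lineH] J by auto
      ultimately show ?thesis by (simp add: restr_eq_0_iff[OF lines_A[OF J], symmetric])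
    qed
    then have "(f, g) \<in> log_pairs d1 ?A" using low by (simp add: log_pairs_def)
    moreover have "card ?A = d1 + d2 - 1"
      using exponents_sum_product(1)[OF C basis] H by (simp add: card_Diff_singleton)
    then have "d1 \<le> card ?A - ?k" using k2 by simp
    ultimately have "form H dvd deriv_form H (f, g)" by (rule restr_deriv_eq_0)
    then have "form H * form H dvd deriv_form H \<phi>" by (simp add: der mult_dvd_mono)
    moreover have "form H * form H dvd deriv_form H \<psi> * fst \<phi>" "form H * form H dvd deriv_form H \<psi> * snd \<phi>"
      using onH(2) by (simp_all add: fg mult_dvd_mono)
    ultimately have "form H * form H dvd pair_det \<phi> \<psi>"
      by (intro dvd_pair_det[OF lineH] dvd_diff) (assumption | rule dvd_mult2, assumption)+
    then show False using no by (simp add: power2_eq_square)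
  qed
qed

theorem points_on_other_line:
  assumes C: "line_arrangement C" and basis: "log_basis C d1 d2 \<phi> \<psi>"
    and L: "affine_line L" "L \<notin> C"
  shows "card (points_on C L) = d1 \<or> d2 \<le> card (points_on C L)"
proof (rule ccontr)
  let ?k = "card (nodes C L)"
  interpret arrangement_with_line C L
    using C L by unfold_locales (auto simp: line_arrangement_def)
  assume "\<not> (card (points_on C L) = d1 \<or> d2 \<le> card (points_on C L))"
  moreover have "C - {L} = C" using L(2) by simp
  ultimately have k: "?k \<noteq> d1" "?k < d2" by (simp_all add: card_points_on[OF C L(1)])
  have no: "\<not> form L dvd pair_det \<phi> \<psi>"
    using pair_det_multiplicity[OF C basis L(1)] L(2) by simp
  note n = exponents_sum_product(1)[OF C basis]
  note log = log_basisD(1,2)[OF basis]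
  have \<phi>: "form L dvd deriv_form L \<phi>"
    using restr_deriv_eq_0[OF log(1)] n k(2) by simp
  show False
  proof (cases "d1 < ?k")
    case True
    then have "form L dvd fst \<phi>" "form L dvd snd \<phi>"
      using form_dvd_components[OF log(1) _ \<phi>] by simp_all
    then have "form L dvd pair_det \<phi> \<psi>" by (simp add: pair_det_def)
    then show False using no by simp
  next
    case False
    then have "?k < d1" using k(1) by simp
    then have "form L dvd deriv_form L \<psi>"
      using restr_deriv_eq_0[OF log(2)] n by simp
    with \<phi> have "form L dvd pair_det \<phi> \<psi>"
      using dvd_pair_det[OF L(1), of "form L" 1 \<phi> \<psi>] by simp
    then show False using no by simp
  qed
qed

lemma char_poly_roots:
  fixes a b :: complex
  assumes "map_poly of_int [:s, - n, 1:] = [:- a, 1:] * [:- (a + b), 1:]"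
  shows "a * (a + b) = of_int s" "a + (a + b) = of_int n"
proof -
  have eq: "[:of_int s, - of_int n, 1:] = [:a * (a + b), - (a + (a + b)), 1:]"
    using assms by (simp add: map_poly_pCons algebra_simps)
  show "a * (a + b) = of_int s" using eq by simp
  show "a + (a + b) = of_int n" using eq by (simp only: pCons_eq_iff neg_equal_iff_equal)
qed

text \<open>The two factorizations of the quadratic polynomial agree up to order, and the absolute values fix
  the order.\<close>

lemma roots_of_exponents:
  fixes a b :: complex
  assumes prod: "a * (a + b) = of_nat d1 * of_nat d2" and sum: "a + (a + b) = of_nat d1 + of_nat d2"
    and le: "cmod a \<le> cmod (a + b)" "d1 \<le> d2"
  shows "a = of_nat d1" "a + b = of_nat d2"
proof -
  have "(a - of_nat d1) * (a - of_nat d2) = a * a - (of_nat d1 + of_nat d2) * a + of_nat d1 * of_nat d2"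
    by (simp add: algebra_simps)
  also have "\<dots> = 0" unfolding prod[symmetric] sum[symmetric] by (simp add: algebra_simps)
  finally have cases: "a = of_nat d1 \<or> a = of_nat d2" by simp
  show a: "a = of_nat d1"
  proof (rule ccontr)
    assume ne: "a \<noteq> of_nat d1"
    with cases have a: "a = of_nat d2" by simp
    with sum have "a + b = of_nat d1" by (metis add.commute add_left_cancel)
    with a le(1) have "real d2 \<le> real d1" by (metis norm_of_nat)
    with le(2) ne a show False by simp
  qed
  show "a + b = of_nat d2" using sum unfolding a by simp
qed

theorem corollary1p2:
  fixes C :: "('a::field ^ 2) set set" and a b :: complex
  assumes "line_arrangement C"
    and "map_poly of_int (char_poly C) = [:- a, 1:] * [:- (a + b), 1:]"
    and "cmod a \<le> cmod (a + b)"
    and "free_arrangement C"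
  shows "(\<forall>H\<in>C. of_nat (card (points_on C H)) \<in> {k \<in> \<int>. k \<le> a} \<union> {a + b}) \<and>
    (\<forall>L. affine_line L \<and> L \<notin> C \<longrightarrow>
      of_nat (card (points_on C L)) \<in> {a} \<union> {k \<in> \<int>. k \<ge> a + b})"
proof -
  note C = assms(1)
  obtain e1 e2 where "free_with_exponents C e1 e2"
    using assms(4) by (auto simp: free_arrangement_def)
  from free_log_basis[OF C this] obtain \<phi>' \<psi>' where basis': "log_basis C e1 e2 \<phi>' \<psi>'" .
  obtain d1 d2 \<phi> \<psi> where basis: "log_basis C d1 d2 \<phi> \<psi>" and le: "d1 \<le> d2"
  proof (cases "e1 \<le> e2")
    case True
    then show ?thesis using that basis' by blast
  next
    case False
    then show ?thesis using that[OF log_basis_swap[OF basis']] by simp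
  qed
  note exps = exponents_sum_product[OF C basis]
  note roots = char_poly_roots[OF assms(2)[unfolded char_poly_eq[OF C]]]
  have "a * (a + b) = of_nat d1 * of_nat d2" "a + (a + b) = of_nat d1 + of_nat d2"
    using roots by (simp_all add: exps)
  from roots_of_exponents[OF this assms(3) le] have a: "a = of_nat d1" and ab: "a + b = of_nat d2" .
  have of_nat_le: "(of_nat m :: complex) \<le> of_nat n \<longleftrightarrow> m \<le> n" for m n
    by (simp add: less_eq_complex_def)
  show ?thesis
  proof (intro conjI ballI allI impI)
    fix H assume "H \<in> C"
    from points_on_line_of_arrangement[OF C basis this]
    show "of_nat (card (points_on C H)) \<in> {k \<in> \<int>. k \<le> a} \<union> {a + b}"
      unfolding a[symmetric] ab by (auto simp: a of_nat_le)
  next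
    fix L assume "affine_line L \<and> L \<notin> C"
    then have "card (points_on C L) = d1 \<or> d2 \<le> card (points_on C L)"
      using points_on_other_line[OF C basis] by blast
    then show "of_nat (card (points_on C L)) \<in> {a} \<union> {k \<in> \<int>. k \<ge> a + b}"
      unfolding ab by (auto simp: a of_nat_le)
  qed
qed

end
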